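(* Let $N\in\{2,3,\dots\}$, $r>0$, $0<t_*<\infty$, $\beta>0$. Consider, for $t\in[0,t_* )$ and $\mathbf x\in\check{\mathbb A}_N^{2\pi r}$, the Kolmogorov operator of the elliptic Dyson model with parameter $\beta$, $$\mathcal L_N^{(\beta)}(t)=\frac12\sum_{j=1}^N\frac{\partial^2}{\partial x_j^2}+\frac\beta2\sum_{j=1}^N\frac{\partial}{\partial x_j}\circ\frac{\partial W_N}{\partial x_j}(t,\mathbf x),$$ i.e. $\mathcal L_N^{(\beta)}(t)f=\frac12\sum_j\partial_{x_j}^2f+\frac\beta2\sum_j\partial_{x_j}\big((\partial_{x_j}W_N)f\big)$. Then, as operators, $$e^{\beta W_N(t,\mathbf x)/2}\left[\frac{\partial}{\partial t}-\mathcal L_N^{(\beta)}(t)\right]e^{-\beta W_N(t,\mathbf x)/2}=\frac{\partial}{\partial t}+\left(\mathcal H_N^{(\beta)}(t)-E_{N,0}^{(\beta)}(t)\right),$$ where $\mathcal H_N^{(\beta)}(t)=-\frac12\sum_{j=1}^N\frac{\partial^2}{\partial x_j^2}+V_N^{(\beta)}(t,\mathbf x)$ with $$V_N^{(\beta)}(t,\mathbf x)=\frac{\beta(\beta-2)}{8}N\left[\sum_{1\le j<k\le N}U_N'(t,x_k-x_j)^2+U_N'(t,\overline x)^2-\frac{N-2}{N}\sum_{1\le j<k\le N}U_N''(t,x_k-x_j)\right]$$ and $$E_{N,0}^{(\beta)}(t)=-\frac{\beta^2}{16}N(N-1)(N-2)\frac1{\pi r}\eta_1(2\pi r,2N\omega_3(t)).$$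 Moreover $V_N^{(\beta)}$ is also expressed as $$V_N^{(\beta)}(t,\mathbf x)=\frac{\beta(\beta-2)}{8}N\Bigg[\sum_{j<k}\Big(\zeta(x_k-x_j)-\frac{x_k-x_j}{\pi r}\eta_1\Big)^2+\Big(\zeta(\overline x)-\frac{\overline x}{\pi r}\eta_1\Big)^2-\frac{N-2}{N}\sum_{j<k}\Big(\wp(x_k-x_j)+\frac1{\pi r}\eta_1\Big)\Bigg],$$ where here $\zeta(\cdot)=\zeta(\cdot\,|2\pi r,2N\omega_3(t))$, $\wp(\cdot)=\wp(\cdot\,|2\pi r,2N\omega_3(t))$ and $\eta_1=\eta_1(2\pi r,2N\omega_3(t))$.
   Context: For $v\in\mathbb C$, $\Im\tau>0$: $\vartheta_1(v;\tau)=i\sum_{n\in\mathbb Z}(-1)^n e^{\pi i\tau(n-1/2)^2}e^{(2n-1)\pi i v}$. $2\omega_3(t)=\frac{i(t_*-t)}{r}$, $\tau(t)=\frac{i(t_*-t)}{2\pi r^2}$, $t\in[0,t_* )$. $U_N(t,x)=-\log\vartheta_1\!\left(\frac{x}{2\pi r};N\tau(t)\right)$, $x\in(0,2\pi r)$; primes denote $\partial/\partial x$. $\kappa_N=\frac{\pi r}{2}(2N-3+(-1)^N)$, $\overline x=\sum_{j=1}^Nx_j-\kappa_N$. $\check{\mathbb A}_N^{2\pi r}=\{\mathbf x\in\mathbb R^N:x_1<\cdots<x_N<x_1+2\pi r,\ \overline x\in(0,2\pi r)\}$. $W_N(t,\mathbf x)=\sum_{1\le j<k\le N}U_N(t,x_k-x_j)+U_N(t,\overline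 x)$. Weierstrass functions with periods $2\omega_1,2\omega_3$, $\Omega_{m,n}=2m\omega_1+2n\omega_3$: $\zeta(z|2\omega_1,2\omega_3)=\frac1z+\sum_{(m,n)\ne(0,0)}\left[\frac1{z-\Omega_{m,n}}+\frac1{\Omega_{m,n}}+\frac z{\Omega_{m,n}^2}\right]$, $\wp(z|2\omega_1,2\omega_3)=\frac1{z^2}+\sum_{(m,n)\ne(0,0)}\left[\frac1{(z-\Omega_{m,n})^2}-\frac1{\Omega_{m,n}^2}\right]$, $\eta_1(2\omega_1,2\omega_3)=\zeta(\omega_1|2\omega_1,2\omega_3)$. Functions such as $e^{\pm\beta W_N/2}$ act as multiplication operators; $e^{\beta W_N/2}[\cdots]e^{-\beta W_N/2}$ is a composition of operators acting on smooth functions of $(t,\mathbf x)$. *)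

theory Defs
  imports "HOL-Analysis.Analysis"
begin

section \<open>Theta function and Weierstrass functions\<close>

definition jacobi_theta1 :: "complex \<Rightarrow> complex \<Rightarrow> complex" where
  "jacobi_theta1 v \<tau> =
     \<i> * (\<Sum>\<^sub>\<infinity>n::int. (-1) powi n * exp (of_real pi * \<i> * \<tau> * (of_int n - 1/2)\<^sup>2)
              * exp ((2 * of_int n - 1) * of_real pi * \<i> * v))"

text \<open>
  The arguments \<open>p\<close> and \<open>q\<close> are the full periods $2\omega_1$ and $2\omega_3$.
  The unordered sums over the nonzero lattice points converge absolutely when \<open>p\<close> and \<open>q\<close>
  are linearly independent over the reals and \<open>z\<close> is not a lattice point.
\<close>

definition weierstrass_zeta :: "complex \<Rightarrow> complex \<Rightarrow> complex \<Rightarrow> complex" where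
  "weierstrass_zeta p q z =
     1 / z + (\<Sum>\<^sub>\<infinity>(m, n) \<in> UNIV - {(0::int, 0::int)}.
                let \<Omega> = of_int m * p + of_int n * q
                in 1 / (z - \<Omega>) + 1 / \<Omega> + z / \<Omega>\<^sup>2)"

definition weierstrass_p :: "complex \<Rightarrow> complex \<Rightarrow> complex \<Rightarrow> complex" where
  "weierstrass_p p q z =
     1 / z\<^sup>2 + (\<Sum>\<^sub>\<infinity>(m, n) \<in> UNIV - {(0::int, 0::int)}.
                 let \<Omega> = of_int m * p + of_int n * q
                 in 1 / (z - \<Omega>)\<^sup>2 - 1 / \<Omega>\<^sup>2)"

definition weierstrass_eta1 :: "complex \<Rightarrow> complex \<Rightarrow> complex" where
  "weierstrass_eta1 p q = weierstrass_zeta p q (p / 2)"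


section \<open>The elliptic Dyson model\<close>

text \<open>
  The particles are indexed by a finite linearly ordered type \<open>'n\<close>, so that $N$ is \<open>CARD('n)\<close>
  and the pairs $j < k$ refer to the order of \<open>'n\<close>. The time horizon $t_*$ is \<open>ts\<close>.
\<close>

definition two_omega3 :: "real \<Rightarrow> real \<Rightarrow> real \<Rightarrow> complex" where
  "two_omega3 r ts t = \<i> * of_real (ts - t) / of_real r"

definition tau :: "real \<Rightarrow> real \<Rightarrow> real \<Rightarrow> complex" where
  "tau r ts t = \<i> * of_real (ts - t) / of_real (2 * pi * r\<^sup>2)"

text \<open>
  For $t < t_*$ and $0 < y < 2\pi r$ the value of the theta function is a positive real, so
  that the principal logarithm is the real one.
\<close>

definition U :: "nat \<Rightarrow> real \<Rightarrow> real \<Rightarrow> real \<Rightarrow> real \<Rightarrow> complex" where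
  "U N r ts t y = - ln (jacobi_theta1 (of_real (y / (2 * pi * r))) (of_nat N * tau r ts t))"

definition U' :: "nat \<Rightarrow> real \<Rightarrow> real \<Rightarrow> real \<Rightarrow> real \<Rightarrow> complex" where
  "U' N r ts t y = vector_derivative (U N r ts t) (at y)"

definition U'' :: "nat \<Rightarrow> real \<Rightarrow> real \<Rightarrow> real \<Rightarrow> real \<Rightarrow> complex" where
  "U'' N r ts t y = vector_derivative (U' N r ts t) (at y)"

definition kappa :: "nat \<Rightarrow> real \<Rightarrow> real" where
  "kappa N r = pi * r / 2 * (2 * real N - 3 + (-1) ^ N)"

definition xbar :: "real \<Rightarrow> real ^ 'n::finite \<Rightarrow> real" where
  "xbar r x = (\<Sum>j\<in>UNIV. x $ j) - kappa CARD('n) r"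

definition alcove :: "real \<Rightarrow> (real ^ 'n::{finite, linorder}) set" where
  "alcove r = {x. (\<forall>j k. j < k \<longrightarrow> x $ j < x $ k)
                \<and> x $ Max UNIV < x $ Min UNIV + 2 * pi * r
                \<and> xbar r x \<in> {0<..<2 * pi * r}}"

definition pairs :: "('n::{finite, linorder} \<times> 'n) set" where
  "pairs = {(j, k). j < k}"

text \<open>
  Functions of $(t, \mathbf x)$ are complex-valued, which includes the real-valued ones.
\<close>

type_synonym 'n fn = "real \<times> (real ^ 'n) \<Rightarrow> complex"

definition W :: "real \<Rightarrow> real \<Rightarrow> 'n::{finite, linorder} fn" where
  "W r ts = (\<lambda>(t, x). (\<Sum>(j, k)\<in>pairs. U CARD('n) r ts t (x $ k - x $ j))
                       + U CARD('n) r ts t (xbar r x))"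


section \<open>Smooth functions and operators\<close>

text \<open>
  \<open>C_k k S f\<close> says that \<open>f\<close> is \<open>k\<close> times continuously differentiable on \<open>S\<close>. All derivatives are
  taken within \<open>S\<close>. On the set $[0, t_*) \times A$ with \<open>A\<close> open they are unique, and at $t = 0$
  they are one-sided in time.
\<close>

primrec C_k :: "nat \<Rightarrow> 'a::euclidean_space set \<Rightarrow> ('a \<Rightarrow> complex) \<Rightarrow> bool" where
  "C_k 0 S f \<longleftrightarrow> continuous_on S f"
| "C_k (Suc k) S f \<longleftrightarrow>
     f differentiable_on S \<and> (\<forall>v. C_k k S (\<lambda>p. frechet_derivative f (at p within S) v))"

definition smooth_on :: "'a::euclidean_space set \<Rightarrow> ('a \<Rightarrow> complex) \<Rightarrow> bool" where
  "smooth_on S f \<longleftrightarrow> (\<forall>k. C_k k S f)"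

definition mult_op :: "'n::finite fn \<Rightarrow> 'n fn \<Rightarrow> 'n fn" where
  "mult_op g f = (\<lambda>p. g p * f p)"

definition d_t :: "real \<Rightarrow> 'n::finite fn \<Rightarrow> 'n fn" where
  "d_t ts f = (\<lambda>(t, x). vector_derivative (\<lambda>s. f (s, x)) (at t within {0..<ts}))"

definition d_x :: "'n::finite \<Rightarrow> 'n fn \<Rightarrow> 'n fn" where
  "d_x j f = (\<lambda>(t, x). vector_derivative (\<lambda>s. f (t, x + s *\<^sub>R axis j 1)) (at 0))"

definition kolmogorov_L :: "real \<Rightarrow> real \<Rightarrow> real \<Rightarrow> 'n::{finite, linorder} fn \<Rightarrow> 'n fn" where
  "kolmogorov_L \<beta> r ts f =
     (\<lambda>p. 1/2 * (\<Sum>j\<in>UNIV. d_x j (d_x j f) p)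
        + of_real \<beta> / 2 * (\<Sum>j\<in>UNIV. d_x j (mult_op (d_x j (W r ts)) f) p))"

definition potential_V :: "real \<Rightarrow> real \<Rightarrow> real \<Rightarrow> 'n::{finite, linorder} fn" where
  "potential_V \<beta> r ts = (\<lambda>(t, x).
     of_real (\<beta> * (\<beta> - 2) / 8) * of_nat CARD('n) *
       ((\<Sum>(j, k)\<in>pairs. (U' CARD('n) r ts t (x $ k - x $ j))\<^sup>2)
        + (U' CARD('n) r ts t (xbar r x))\<^sup>2
        - (of_nat CARD('n) - 2) / of_nat CARD('n)
          * (\<Sum>(j, k)\<in>pairs. U'' CARD('n) r ts t (x $ k - x $ j))))"

definition hamiltonian_H :: "real \<Rightarrow> real \<Rightarrow> real \<Rightarrow> 'n::{finite, linorder} fn \<Rightarrow> 'n fn" where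
  "hamiltonian_H \<beta> r ts f =
     (\<lambda>p. - 1/2 * (\<Sum>j\<in>UNIV. d_x j (d_x j f) p) + potential_V \<beta> r ts p * f p)"

definition energy_E0 :: "nat \<Rightarrow> real \<Rightarrow> real \<Rightarrow> real \<Rightarrow> real \<Rightarrow> complex" where
  "energy_E0 N \<beta> r ts t =
     - (of_real (\<beta>\<^sup>2) / 16) * of_nat N * (of_nat N - 1) * (of_nat N - 2) * (1 / of_real (pi * r))
       * weierstrass_eta1 (of_real (2 * pi * r)) (of_nat N * two_omega3 r ts t)"

definition exp_W :: "real \<Rightarrow> real \<Rightarrow> real \<Rightarrow> 'n::{finite, linorder} fn" where
  "exp_W c r ts = (\<lambda>p. exp (of_real c * W r ts p))"

end

theory Submission
  imports Defs "HOL-Complex_Analysis.Conformal_Mappings"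
begin

text \<open>
  Conjugating with $e^{\beta W/2}$ cancels the first order terms and leaves the potential
  $-\frac\beta2 \partial_t W - \frac\beta4 \Delta W + \frac{\beta^2}8 |\nabla W|^2$.
  The heat equation of the theta function expresses $\partial_t W$ through $U'^2 - U''$.
  The mixed products in $|\nabla W|^2$ are removed by
  $(\zeta(a) + \zeta(b) + \zeta(c))^2 = \wp(a) + \wp(b) + \wp(c)$ for $a + b + c = 0$,
  because $U' = - \zeta + (y / \pi r) \eta_1$ and the linear terms cancel in the sum over a triangle.

  All identities between elliptic functions are instances of Liouville's theorem.
  In particular the theta series is a nonzero constant times the product side of the Jacobi triple
  product, which locates its zeros, and its logarithmic derivative then
  differs from $\zeta$ by a linear function that is fixed by periodicity and oddness.
\<close>


section \<open>Termwise differentiation and period lattices\<close>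

text \<open>The final shape rests on a match of coefficients. The modulus \<open>N * tau\<close>
  puts a factor \<open>N / 2\<close> into the heat equation, and the squared gradient also carries
  the sum of the \<open>U'\<close>-squares with weight \<open>N\<close>; so both contributions merge
  into \<open>\<beta> * (\<beta> - 2) / 8 * N\<close>. The second derivative at \<open>xbar\<close>
  cancels between the time derivative and the Laplacian, and the pair terms \<open>U''\<close> are
  left with the weight \<open>N - 2\<close> in either power of \<open>\<beta>\<close>. The
  three-term relation speaks of \<open>wp\<close> rather than \<open>U''\<close>; their difference
  \<open>eta / (pi * r)\<close>, counted once per pair, is the energy. The zeros of the theta series
  cannot be read off termwise, those of a product can. Dividing the series by the product gives a
  function with a known denominator, so that no contour integral has to count zeros. The value of
  the constant quotient is irrelevant once it is nonzero, and this is seen at the half period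
  \<open>p / 2\<close>, where a purely imaginary ratio of the periods makes every term of the series
  positive.\<close>

text \<open>Only the functions are dominated, not their derivatives: a locally uniform limit of
  holomorphic functions may be differentiated termwise. The finite set \<open>B\<close> holds the
  indices whose terms escape the bound, later the lattice points of size comparable to
  \<open>z\<close>; they are added back as a finite sum.\<close>

lemma has_field_derivative_infsum:
  fixes f f' :: "'k \<Rightarrow> complex \<Rightarrow> complex"
  assumes deriv: "\<And>k w. k \<in> A \<Longrightarrow> w \<in> cball z r \<Longrightarrow> (f k has_field_derivative f' k w) (at w)"
    and r: "0 < r" and B: "finite B"
    and M: "M summable_on (A - B)"
    and bound: "\<And>k w. k \<in> A - B \<Longrightarrow> w \<in> cball z r \<Longrightarrow> norm (f k w) \<le> M k"
  shows "((\<lambda>w. \<Sum>\<^sub>\<infinity>k\<in>A. f k w) has_field_derivative (\<Sum>\<^sub>\<infinity>k\<in>A. f' k z)) (at z)"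
    and "(\<lambda>k. f' k z) summable_on A"
    and "(\<lambda>k. f k z) summable_on A"
proof -
  let ?A = "A - B" and ?F = "finite_subsets_at_top (A - B)"
  let ?g = "\<lambda>w. \<Sum>\<^sub>\<infinity>k\<in>?A. f k w"
  have lim: "uniform_limit (cball z r) (\<lambda>X w. \<Sum>k\<in>X. f k w) ?g ?F"
    using bound M by (rule Weierstrass_m_test_general)
  have "\<forall>\<^sub>F X in ?F. finite X \<and> X \<subseteq> ?A"
    by (simp add: eventually_finite_subsets_at_top) blast
  then have cont: "\<forall>\<^sub>F X in ?F. continuous_on (cball z r) (\<lambda>w. \<Sum>k\<in>X. f k w) \<and>
     (\<forall>w\<in>ball z r. ((\<lambda>w. \<Sum>k\<in>X. f k w) has_field_derivative (\<Sum>k\<in>X. f' k w)) (at w))"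
  proof eventually_elim
    case (elim X)
    have *: "((\<lambda>w. \<Sum>k\<in>X. f k w) has_field_derivative (\<Sum>k\<in>X. f' k w)) (at w)"
      if "w \<in> cball z r" for w
      using elim that by (intro DERIV_sum deriv) auto
    then show ?case
      by (force intro!: DERIV_continuous_on[of _ _ "\<lambda>w. \<Sum>k\<in>X. f' k w"] intro: has_field_derivative_at_within)
  qed
  obtain g' where g': "\<And>w. w \<in> ball z r \<Longrightarrow>
      (?g has_field_derivative g' w) (at w) \<and> ((\<lambda>X. \<Sum>k\<in>X. f' k w) \<longlongrightarrow> g' w) ?F"
    using has_complex_derivative_uniform_limit[OF cont lim _ r] by (auto simp: finite_subsets_at_top_neq_bot)
  have z: "z \<in> ball z r" using r by simp
  have sum': "((\<lambda>k. f' k z) has_sum g' z) ?A"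
    using g'[OF z] by (simp add: has_sum_def)
  have summ: "(\<lambda>k. f k w) summable_on ?A" if "w \<in> cball z r" for w
    using M bound that by (intro abs_summable_summable[OF summable_on_comparison_test[OF M]]) auto
  have A: "A = ?A \<union> (A \<inter> B)" "?A \<inter> (A \<inter> B) = {}" "finite (A \<inter> B)" using B by auto
  show s': "(\<lambda>k. f' k z) summable_on A"
    using sum' A by (metis has_sum_imp_summable summable_on_Un_disjoint summable_on_finite)
  show "(\<lambda>k. f k z) summable_on A"
    using summ[of z] r A by (metis centre_in_cball less_imp_le summable_on_Un_disjoint summable_on_finite)
  have split: "(\<Sum>\<^sub>\<infinity>k\<in>A. h k) = (\<Sum>\<^sub>\<infinity>k\<in>?A. h k) + (\<Sum>k\<in>A \<inter> B. h k)" 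
    if "h summable_on ?A" for h :: "'k \<Rightarrow> complex"
    by (subst A(1), subst infsum_Un_disjoint) (use that A in auto)
  have "((\<lambda>w. ?g w + (\<Sum>k\<in>A \<inter> B. f k w)) has_field_derivative g' z + (\<Sum>k\<in>A \<inter> B. f' k z)) (at z)"
    using g'[OF z] r by (intro derivative_intros deriv) auto
  moreover have "g' z + (\<Sum>k\<in>A \<inter> B. f' k z) = (\<Sum>\<^sub>\<infinity>k\<in>A. f' k z)"
    using sum' by (subst split) (auto simp: has_sum_iff)
  ultimately have "((\<lambda>w. ?g w + (\<Sum>k\<in>A \<inter> B. f k w)) has_field_derivative (\<Sum>\<^sub>\<infinity>k\<in>A. f' k z)) (at z)"
    by simp
  then show "((\<lambda>w. \<Sum>\<^sub>\<infinity>k\<in>A. f k w) has_field_derivative (\<Sum>\<^sub>\<infinity>k\<in>A. f' k z)) (at z)"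
  proof (rule has_field_derivative_transform_within[where d = r])
    show "?g w + (\<Sum>k\<in>A \<inter> B. f k w) = (\<Sum>\<^sub>\<infinity>k\<in>A. f k w)" if "dist w z < r" for w
      using that summ[of w] by (subst split) (auto simp: dist_commute)
  qed (use r in auto)
qed

lemma summable_on_int_abs:
  fixes g :: "nat \<Rightarrow> real"
  assumes "summable g" "\<And>n. 0 \<le> g n"
  shows "(\<lambda>n::int. g (nat \<bar>n\<bar>)) summable_on UNIV" (is "?f summable_on UNIV")
proof -
  have s: "g summable_on UNIV"
    using assms by (intro norm_summable_imp_summable_on) simp
  have "?f summable_on (range int)"
    by (subst summable_on_reindex) (use s in \<open>auto simp: o_def\<close>)
  moreover have "?f summable_on (range (\<lambda>n. - int n))"
    by (subst summable_on_reindex) (use s in \<open>auto simp: o_def inj_def\<close>)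
  moreover have "UNIV = range int \<union> range (\<lambda>n. - int n)"
    using int_cases2 by blast
  ultimately show ?thesis by (metis summable_on_union)
qed

lemma summable_int_powr:
  "(\<lambda>n::int. (1 + real_of_int \<bar>n\<bar>) powr (-3/2)) summable_on UNIV"
proof -
  have "summable (\<lambda>n::nat. (1 + real n) powr (-3/2))"
    using summable_ignore_initial_segment[of "\<lambda>n::nat. real n powr (-3/2)" 1]
    by (simp add: summable_real_powr_iff add.commute)
  from summable_on_int_abs[OF this] show ?thesis by simp
qed

section \<open>Discreteness of a period lattice and its cubic sum\<close>

locale period_lattice =
  fixes p q :: complex
  assumes p_nz: "p \<noteq> 0" and Im_ratio: "0 < Im (q / p)"
begin

definition om :: "int \<times> int \<Rightarrow> complex" where
  "om k = of_int (fst k) * p + of_int (snd k) * q"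

definition Lam :: "complex set" where "Lam = range om"

lemma om_0 [simp]: "om (0, 0) = 0" by (simp add: om_def)
lemma om_minus: "om (- k) = - om k" by (simp add: om_def)
lemma om_diff: "om (k - l) = om k - om l" by (simp add: om_def algebra_simps)
lemma om_add: "om (k + l) = om k + om l" by (simp add: om_def algebra_simps)

text \<open>After division by \<open>p\<close>, the imaginary part of \<open>m + n * \<tau>\<close>
  bounds \<open>n\<close>, and the triangle inequality then bounds \<open>m\<close>;
  \<open>K\<close> is large enough for both.\<close>

lemma om_lower:
  obtains c where "0 < c" "\<And>m n. c * real_of_int (max \<bar>m\<bar> \<bar>n\<bar>) \<le> norm (om (m, n))"
proof -
  define \<tau> where "\<tau> = q / p"
  define K where "K = 1 + (1 + norm \<tau>) / Im \<tau>"
  have t: "Im \<tau> > 0" using Im_ratio by (simp add: \<tau>_def)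
  have K: "K > 0" using t by (simp add: K_def add_pos_nonneg)
  have le: "real_of_int (max \<bar>m\<bar> \<bar>n\<bar>) \<le> K * norm (of_int m + of_int n * \<tau>)" for m n
  proof -
    define L where "L = norm (of_int m + of_int n * \<tau>)"
    have "\<bar>Im (of_int m + of_int n * \<tau>)\<bar> \<le> L" unfolding L_def by (rule abs_Im_le_cmod)
    then have n: "\<bar>real_of_int n\<bar> \<le> L / Im \<tau>" using t by (simp add: abs_mult field_simps)
    have "norm (of_int m :: complex) \<le> L + norm (of_int n * \<tau>)"
      unfolding L_def by (metis add_diff_cancel_right' norm_triangle_ineq4)
    then have "\<bar>real_of_int m\<bar> \<le> L + \<bar>real_of_int n\<bar> * norm \<tau>" by (simp add: norm_mult)
    also have "\<dots> \<le> L + L / Im \<tau> * norm \<tau>" using n by (intro add_left_mono mult_right_mono) auto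
    finally have m: "\<bar>real_of_int m\<bar> \<le> L + L / Im \<tau> * norm \<tau>" .
    have "L \<ge> 0" by (simp add: L_def)
    then have "L / Im \<tau> \<le> K * L" "L + L / Im \<tau> * norm \<tau> \<le> K * L"
      using t by (auto simp: K_def field_simps)
    with m n show ?thesis unfolding L_def[symmetric] by (auto simp: max_def)
  qed
  show thesis
  proof
    show "norm p / K > 0" using K p_nz by simp
    show "norm p / K * real_of_int (max \<bar>m\<bar> \<bar>n\<bar>) \<le> norm (om (m, n))" for m n
    proof -
      have "om (m, n) = p * (of_int m + of_int n * \<tau>)" using p_nz by (simp add: om_def \<tau>_def field_simps)
      then have "norm (om (m, n)) = norm p * norm (of_int m + of_int n * \<tau>)" by (simp only: norm_mult)
      then show ?thesis using mult_left_mono[OF le[of m n], of "norm p"] K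
        by (simp add: divide_le_eq mult.commute mult.left_commute)
    qed
  qed
qed

lemma om_eq_0_iff [simp]: "om k = 0 \<longleftrightarrow> k = (0, 0)"
proof
  assume "om k = 0"
  obtain c where "0 < c" and c: "\<And>m n. c * real_of_int (max \<bar>m\<bar> \<bar>n\<bar>) \<le> norm (om (m, n))"
    by (rule om_lower) blast
  have "real_of_int (max \<bar>fst k\<bar> \<bar>snd k\<bar>) \<le> 0"
    using c[of "fst k" "snd k"] \<open>om k = 0\<close> \<open>0 < c\<close> by (simp add: mult_le_0_iff del: of_int_max)
  then show "k = (0, 0)" by (cases k) (auto simp: max_def split: if_splits)
qed simp

lemma inj_om: "inj om"
proof (rule injI)
  fix k l assume "om k = om l"
  then have "om (k - l) = 0" by (simp add: om_diff)
  then have "k - l = (0, 0)" by (simp only: om_eq_0_iff)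
  then show "k = l" by (metis eq_iff_diff_eq_0 zero_prod_def)
qed

lemma finite_om_small: "finite {k. norm (om k) \<le> R}"
proof -
  obtain c where "0 < c" and c: "\<And>m n. c * real_of_int (max \<bar>m\<bar> \<bar>n\<bar>) \<le> norm (om (m, n))"
    by (rule om_lower) blast
  let ?b = "\<lceil>R / c\<rceil>"
  have "{k. norm (om k) \<le> R} \<subseteq> {- ?b..?b} \<times> {- ?b..?b}"
  proof safe
    fix m n assume "norm (om (m, n)) \<le> R"
    then have "real_of_int (max \<bar>m\<bar> \<bar>n\<bar>) \<le> R / c"
      using c[of m n] \<open>0 < c\<close> by (simp add: field_simps)
    then have "max \<bar>m\<bar> \<bar>n\<bar> \<le> ?b" by linarith
    then show "m \<in> {- ?b..?b}" "n \<in> {- ?b..?b}" by auto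
  qed
  then show ?thesis by (rule finite_subset) auto
qed

text \<open>The inverse cube of \<open>max |m| |n|\<close> is dominated by a product of two weights
  with exponent -3/2, one in \<open>m\<close> and one in \<open>n\<close>. Each of them is summable
  over the integers, so the double sum factorizes.\<close>

lemma summable_om_cubed: "(\<lambda>k. 1 / norm (om k) ^ 3) summable_on UNIV"
proof -
  obtain c where c0: "0 < c" and c: "\<And>m n. c * real_of_int (max \<bar>m\<bar> \<bar>n\<bar>) \<le> norm (om (m, n))"
    by (rule om_lower) blast
  define a where "a = (\<lambda>n::int. (1 + real_of_int \<bar>n\<bar>) powr (-3/2))"
  have "(\<lambda>(m, n). a m * a n) summable_on (UNIV \<times> UNIV)"
    by (rule summable_on_SigmaI[where g = "\<lambda>m. a m * infsum a UNIV"])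
       (use summable_int_powr in \<open>auto simp: a_def intro!: has_sum_cmult_right has_sum_infsum summable_on_cmult_left\<close>)
  \<comment> \<open>The 8 undoes the cube of 2 in \<open>(2 * M) ^ 3\<close>, which enters because
    \<open>1 + |l| <= 2 * M\<close> for either coordinate \<open>l\<close>.\<close>
  then have s: "(\<lambda>k. 8 / c ^ 3 * (a (fst k) * a (snd k))) summable_on UNIV"
    by (intro summable_on_cmult_right) (simp add: case_prod_unfold)
  show ?thesis
  proof (rule summable_on_comparison_test[OF s])
    fix k :: "int \<times> int"
    obtain m n where k: "k = (m, n)" by (cases k)
    show "1 / norm (om k) ^ 3 \<le> 8 / c ^ 3 * (a (fst k) * a (snd k))"
    proof (cases "k = (0, 0)")
      case False
      define M where "M = real_of_int (max \<bar>m\<bar> \<bar>n\<bar>)"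
      have M: "M \<ge> 1" using False k by (auto simp: M_def max_def)
      have *: "(2 * M) powr (-3/2) \<le> a l" if "\<bar>l\<bar> \<le> max \<bar>m\<bar> \<bar>n\<bar>" for l
      proof -
        have "real_of_int \<bar>l\<bar> \<le> M" unfolding M_def using that by (simp only: of_int_le_iff)
        then show ?thesis unfolding a_def using M by (intro powr_mono2') auto
      qed
      have "1 / (2 * M) ^ 3 = (2 * M) powr (-3/2) * (2 * M) powr (-3/2)"
        using M by (simp flip: powr_add add: powr_minus powr_numeral field_simps)
      also have "\<dots> \<le> a m * a n" by (intro mult_mono *) (auto simp: a_def)
      finally have "8 / c ^ 3 * (1 / (2 * M) ^ 3) \<le> 8 / c ^ 3 * (a m * a n)"
        using c0 by (intro mult_left_mono) auto
      moreover have "(c * M) ^ 3 \<le> norm (om k) ^ 3" using c[of m n] c0 M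
        by (intro power_mono) (auto simp: M_def k)
      then have "1 / norm (om k) ^ 3 \<le> 1 / (c * M) ^ 3"
        using c0 M False by (intro divide_left_mono mult_pos_pos zero_less_power) auto
      ultimately show ?thesis using k by (simp add: power_mult_distrib)
    qed (use c0 in \<open>simp add: a_def\<close>)
  qed auto
qed

lemma Lam_periodic [simp]: "z + om k \<in> Lam \<longleftrightarrow> z \<in> Lam"
  unfolding Lam_def by (metis (no_types, lifting) add_diff_cancel_right' om_add om_diff rangeE rangeI)

lemma Lam_minus [simp]: "- z \<in> Lam \<longleftrightarrow> z \<in> Lam"
proof -
  have "- w \<in> Lam" if "w \<in> Lam" for w
    using that unfolding Lam_def by (metis om_minus rangeE rangeI)
  from this[of z] this[of "- z"] show ?thesis by auto
qed

lemma zero_in_Lam [simp]: "0 \<in> Lam"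
  unfolding Lam_def by (metis om_0 rangeI)

lemma om_p: "om (1, 0) = p" and om_q: "om (0, 1) = q" by (simp_all add: om_def)

lemma Lam_plus_p [simp]: "z + p \<in> Lam \<longleftrightarrow> z \<in> Lam" and Lam_plus_q [simp]: "z + q \<in> Lam \<longleftrightarrow> z \<in> Lam"
  using Lam_periodic[of z "(1,0)"] Lam_periodic[of z "(0,1)"] by (simp_all only: om_p om_q)

text \<open>Distinct lattice points are at least \<open>c\<close> apart, so every set of them is
  closed. Arbitrary \<open>A\<close> is allowed because the sums below are also taken without the
  term at the origin.\<close>

lemma closed_om_image: "closed (om ` A)"
proof -
  obtain c where c0: "0 < c" and c: "\<And>m n. c * real_of_int (max \<bar>m\<bar> \<bar>n\<bar>) \<le> norm (om (m, n))"
    by (rule om_lower) blast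
  have "k = l" if "dist (om k) (om l) < c" for k l
  proof (rule ccontr)
    assume "k \<noteq> l"
    obtain m n where mn: "k - l = (m, n)" by (cases "k - l")
    then have "1 \<le> max \<bar>m\<bar> \<bar>n\<bar>" using \<open>k \<noteq> l\<close> by (cases k; cases l) (auto simp: max_def)
    then have "c * 1 \<le> c * real_of_int (max \<bar>m\<bar> \<bar>n\<bar>)" using c0 by (intro mult_left_mono) linarith+
    also have "\<dots> \<le> norm (om (k - l))" using c mn by simp
    finally show False using that by (simp add: dist_norm om_diff)
  qed
  then show ?thesis by (intro discrete_imp_closed[OF c0]) blast
qed

lemma open_compl_om_image: "open (- om ` A)"
  using closed_om_image by (simp add: open_Compl)

lemma connected_compl_Lam: "connected (- Lam)"
  unfolding Lam_def by (intro path_connected_imp_connected path_connected_complement_countable) auto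

text \<open>
  As \<open>1 / 0 = 0\<close>, the summands for \<open>k = (0, 0)\<close> are $1/z$ and $1/z^2$, so that the sums over \<open>UNIV\<close> are
  $\zeta$ and $\wp$.
\<close>

definition zterm :: "int \<times> int \<Rightarrow> complex \<Rightarrow> complex" where
  "zterm k z = 1 / (z - om k) + 1 / om k + z / (om k)\<^sup>2"

definition pterm :: "int \<times> int \<Rightarrow> complex \<Rightarrow> complex" where
  "pterm k z = 1 / (z - om k)\<^sup>2 - 1 / (om k)\<^sup>2"

text \<open>The index set is a parameter so that the same calculus serves the full function
  (\<open>UNIV\<close>) and its part regular at 0 (\<open>UNIV - {(0, 0)}\<close>).\<close>

definition zeta_on :: "(int \<times> int) set \<Rightarrow> complex \<Rightarrow> complex" where
  "zeta_on A z = (\<Sum>\<^sub>\<infinity>k\<in>A. zterm k z)"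

definition wp_on :: "(int \<times> int) set \<Rightarrow> complex \<Rightarrow> complex" where
  "wp_on A z = (\<Sum>\<^sub>\<infinity>k\<in>A. pterm k z)"

definition wp'_on :: "(int \<times> int) set \<Rightarrow> complex \<Rightarrow> complex" where
  "wp'_on A z = (\<Sum>\<^sub>\<infinity>k\<in>A. - 2 / (z - om k) ^ 3)"

section \<open>Domination and termwise differentiation of the Weierstrass series\<close>

text \<open>The correction terms combine with the pole into
  \<open>w^2 / ((w - om k) * (om k)^2)\<close>, and \<open>norm (w - om k)\<close> is at least half
  of \<open>norm (om k)\<close>: hence cubic decay.\<close>

lemma norm_zterm_le:
  assumes "norm w \<le> R" "2 * R < norm (om k)"
  shows "norm (zterm k w) \<le> 2 * R\<^sup>2 * (1 / norm (om k) ^ 3)"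
proof -
  let ?o = "om k"
  have R: "R \<ge> 0" using assms(1) norm_ge_zero order_trans by blast
  have far: "norm ?o / 2 \<le> norm (w - ?o)" using assms norm_triangle_ineq2[of ?o w] by (simp add: norm_minus_commute)
  have nz: "?o \<noteq> 0" "w - ?o \<noteq> 0" using assms R far by auto
  have "zterm k w = w\<^sup>2 / ((w - ?o) * ?o\<^sup>2)"
    using nz unfolding zterm_def by (simp add: divide_simps) (simp add: power2_eq_square algebra_simps)
  then have "norm (zterm k w) = (norm w)\<^sup>2 / (norm (w - ?o) * (norm ?o)\<^sup>2)"
    by (simp add: norm_divide norm_mult norm_power)
  also have "\<dots> \<le> R\<^sup>2 / (norm ?o / 2 * (norm ?o)\<^sup>2)"
    using assms far nz R by (intro frac_le mult_right_mono power_mono mult_pos_pos) auto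
  finally show ?thesis by (simp add: power2_eq_square power3_eq_cube ac_simps)
qed

text \<open>Over a common denominator the numerator \<open>w * (2 * om k - w)\<close> is linear in
  \<open>om k\<close>, against a fourth power below. The 10 is 5/2 from the numerator times 4 from
  the squared half distance.\<close>

lemma norm_pterm_le:
  assumes "norm w \<le> R" "2 * R < norm (om k)"
  shows "norm (pterm k w) \<le> 10 * R * (1 / norm (om k) ^ 3)"
proof -
  let ?o = "om k"
  have R: "R \<ge> 0" using assms(1) norm_ge_zero order_trans by blast
  have far: "norm ?o / 2 \<le> norm (w - ?o)" using assms norm_triangle_ineq2[of ?o w] by (simp add: norm_minus_commute)
  have nz: "?o \<noteq> 0" "w - ?o \<noteq> 0" using assms R far by auto
  have num: "norm (2 * ?o - w) \<le> 5 / 2 * norm ?o"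
    using assms R norm_triangle_ineq4[of "2 * ?o" w] by (simp add: norm_mult)
  have "pterm k w = w * (2 * ?o - w) / ((w - ?o)\<^sup>2 * ?o\<^sup>2)"
    using nz unfolding pterm_def by (simp add: divide_simps) (simp add: power2_eq_square algebra_simps)
  then have "norm (pterm k w) = norm w * norm (2 * ?o - w) / ((norm (w - ?o))\<^sup>2 * (norm ?o)\<^sup>2)"
    by (simp add: norm_divide norm_mult norm_power)
  also have "\<dots> \<le> R * (5 / 2 * norm ?o) / ((norm ?o / 2)\<^sup>2 * (norm ?o)\<^sup>2)"
    using assms far nz R num
    by (intro frac_le mult_mono mult_right_mono power_mono mult_pos_pos mult_nonneg_nonneg) auto
  also have "\<dots> = 10 * R * (1 / norm ?o ^ 3)"
    using nz by (simp add: divide_simps) (simp add: power2_eq_square power3_eq_cube eval_nat_numeral)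
  finally show ?thesis .
qed

lemma zeta_on:
  assumes "z \<notin> om ` A"
  shows "(zeta_on A has_field_derivative - wp_on A z) (at z)" 
    and "(\<lambda>k. zterm k z) summable_on A" and "(\<lambda>k. pterm k z) summable_on A"
proof -
  obtain r where r: "r > 0" "cball z r \<subseteq> - om ` A"
    using open_compl_om_image[of A] assms open_contains_cball by (metis ComplI)
  have d: "(zterm k has_field_derivative - pterm k w) (at w)" if "k \<in> A" "w \<in> cball z r" for k w
  proof -
    have "w \<noteq> om k" using r that by auto
    \<comment> \<open>At \<open>om k = 0\<close> the correction terms vanish by
      \<open>1 / 0 = 0\<close> and the summand is the bare pole, so this case is differentiated
      separately.\<close>
    then show ?thesis unfolding zterm_def pterm_def
      by (cases "om k = 0") (auto simp del: om_eq_0_iff intro!: derivative_eq_intros simp: power2_eq_square)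
  qed
  define R where "R = norm z + r"
  have b: "norm (zterm k w) \<le> 2 * R\<^sup>2 * (1 / norm (om k) ^ 3)"
    if "k \<in> A - {k. norm (om k) \<le> 2 * R}" "w \<in> cball z r" for k w
  proof (rule norm_zterm_le)
    have "norm w \<le> norm z + norm (w - z)" by (metis add.commute diff_add_cancel norm_triangle_ineq)
    then show "norm w \<le> R" using that by (auto simp: R_def dist_norm norm_minus_commute)
  qed (use that in auto)
  note * = has_field_derivative_infsum[OF d r(1) finite_om_small _ b]
  have M: "(\<lambda>k. 2 * R\<^sup>2 * (1 / norm (om k) ^ 3)) summable_on (A - {k. norm (om k) \<le> 2 * R})"
    by (intro summable_on_cmult_right summable_on_subset_banach[OF summable_om_cubed]) auto
  show "(zeta_on A has_field_derivative - wp_on A z) (at z)"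
    unfolding zeta_on_def wp_on_def using *(1)[OF _ _ M] by (simp add: infsum_uminus)
  show "(\<lambda>k. zterm k z) summable_on A" "(\<lambda>k. pterm k z) summable_on A"
    using *(2,3)[OF _ _ M] by (simp_all add: summable_on_uminus)
qed

lemma wp_on:
  assumes "z \<notin> om ` A"
  shows "(wp_on A has_field_derivative wp'_on A z) (at z)"
proof -
  obtain r where r: "r > 0" "cball z r \<subseteq> - om ` A"
    using open_compl_om_image[of A] assms open_contains_cball by (metis ComplI)
  have d: "(pterm k has_field_derivative - 2 / (w - om k) ^ 3) (at w)" if "k \<in> A" "w \<in> cball z r" for k w
  proof -
    have "w \<noteq> om k" using r that by auto
    then have "((\<lambda>z. 1 / (z - om k)\<^sup>2) has_field_derivative - 2 / (w - om k) ^ 3) (at w)"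
      by (auto intro!: derivative_eq_intros)
         (simp add: divide_simps power2_eq_square power3_eq_cube, simp add: eval_nat_numeral algebra_simps)
    then show ?thesis unfolding pterm_def using DERIV_diff[OF _ DERIV_const] by fastforce
  qed
  define R where "R = norm z + r"
  have b: "norm (pterm k w) \<le> 10 * R * (1 / norm (om k) ^ 3)"
    if "k \<in> A - {k. norm (om k) \<le> 2 * R}" "w \<in> cball z r" for k w
  proof (rule norm_pterm_le)
    have "norm w \<le> norm z + norm (w - z)" by (metis add.commute diff_add_cancel norm_triangle_ineq)
    then show "norm w \<le> R" using that by (auto simp: R_def dist_norm norm_minus_commute)
  qed (use that in auto)
  have M: "(\<lambda>k. 10 * R * (1 / norm (om k) ^ 3)) summable_on (A - {k. norm (om k) \<le> 2 * R})"
    by (intro summable_on_cmult_right summable_on_subset_banach[OF summable_om_cubed]) auto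
  show ?thesis
    unfolding wp_on_def wp'_on_def
    by (rule has_field_derivative_infsum(1)[OF d r(1) finite_om_small M b])
qed

abbreviation "zeta \<equiv> weierstrass_zeta p q"
abbreviation "wp \<equiv> weierstrass_p p q"
abbreviation "eta \<equiv> weierstrass_eta1 p q"

section \<open>Parity and quasi-periodicity of zeta and wp\<close>

lemma infsum_insert_zero:
  fixes f :: "int \<times> int \<Rightarrow> complex"
  assumes "f summable_on (UNIV - {(0, 0)})"
  shows "infsum f UNIV = f (0, 0) + infsum f (UNIV - {(0, 0)})"
  using infsum_Un_disjoint[of f "{(0, 0)}" "UNIV - {(0, 0)}"] assms by simp

lemma zeta_split: "zeta z = 1 / z + zeta_on (UNIV - {(0, 0)}) z"
  unfolding weierstrass_zeta_def zeta_on_def zterm_def om_def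
  by (simp add: case_prod_unfold Let_def)

lemma wp_split: "wp z = 1 / z\<^sup>2 + wp_on (UNIV - {(0, 0)}) z"
  unfolding weierstrass_p_def wp_on_def pterm_def om_def
  by (simp add: case_prod_unfold Let_def)

lemma zeta_eq: 
  assumes "z \<notin> Lam" shows "zeta z = zeta_on UNIV z"
proof -
  have "z \<notin> om ` (UNIV - {(0, 0)})" using assms by (auto simp: Lam_def)
  from infsum_insert_zero[OF zeta_on(2)[OF this]] show ?thesis
    by (simp add: zeta_split zeta_on_def) (simp add: zterm_def)
qed

lemma wp_eq: 
  assumes "z \<notin> Lam" shows "wp z = wp_on UNIV z"
proof -
  have "z \<notin> om ` (UNIV - {(0, 0)})" using assms by (auto simp: Lam_def)
  from infsum_insert_zero[OF zeta_on(3)[OF this]] show ?thesis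
    by (simp add: wp_split wp_on_def) (simp add: pterm_def)
qed

lemma open_compl_Lam: "open (- Lam)" unfolding Lam_def by (rule open_compl_om_image)

lemma zeta_deriv: 
  assumes "z \<notin> Lam" shows "(zeta has_field_derivative - wp z) (at z)"
proof -
  have "(zeta_on UNIV has_field_derivative - wp z) (at z)"
    using zeta_on(1)[of z UNIV] assms by (simp add: wp_eq Lam_def)
  then show ?thesis
    by (rule has_field_derivative_transform_within_open[OF _ open_compl_Lam]) (use assms in \<open>auto simp: zeta_eq\<close>)
qed

lemma wp_deriv: 
  assumes "z \<notin> Lam" shows "(wp has_field_derivative wp'_on UNIV z) (at z)"
proof -
  have "(wp_on UNIV has_field_derivative wp'_on UNIV z) (at z)"
    using wp_on[of z UNIV] assms by (simp add: Lam_def)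
  then show ?thesis
    by (rule has_field_derivative_transform_within_open[OF _ open_compl_Lam]) (use assms in \<open>auto simp: wp_eq\<close>)
qed

lemma infsum_minus_index:
  fixes f :: "int \<times> int \<Rightarrow> complex"
  shows "(\<Sum>\<^sub>\<infinity>k. f (- k)) = (\<Sum>\<^sub>\<infinity>k. f k)"
proof -
  have "bij_betw uminus (UNIV :: (int \<times> int) set) UNIV"
    by (rule bij_betw_byWitness[of _ uminus]) auto
  then show ?thesis by (rule infsum_reindex_bij_betw)
qed

lemma zeta_minus: 
  assumes "z \<notin> Lam" shows "zeta (- z) = - zeta z"
proof -
  have "zterm k (- z) = - zterm (- k) z" for k
  proof -
    have "- z - om k = - (z - om (- k))" by (simp add: om_minus)
    then have "1 / (- z - om k) = - (1 / (z - om (- k)))" by (metis minus_divide_right)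
    then show ?thesis by (simp add: zterm_def om_minus)
  qed
  then have "zeta_on UNIV (- z) = - zeta_on UNIV z"
    unfolding zeta_on_def using infsum_minus_index[of "\<lambda>k. zterm k z"] by (simp add: infsum_uminus)
  then show ?thesis using assms by (simp add: zeta_eq)
qed

lemma wp_minus: 
  assumes "z \<notin> Lam" shows "wp (- z) = wp z"
proof -
  have "pterm k (- z) = pterm (- k) z" for k
  proof -
    have "- z - om k = - (z - om (- k))" by (simp add: om_minus)
    then have "(- z - om k)\<^sup>2 = (z - om (- k))\<^sup>2" by (metis power2_minus)
    then show ?thesis by (simp add: pterm_def om_minus)
  qed
  then have "wp_on UNIV (- z) = wp_on UNIV z"
    unfolding wp_on_def using infsum_minus_index[of "\<lambda>k. pterm k z"] by simp
  then show ?thesis using assms by (simp add: wp_eq)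
qed

text \<open>This series has no correction terms, so a translation by a lattice point is a mere
  reindexing. Those of \<open>zeta\<close> and \<open>wp\<close> prevent the same argument, and
  their periodicity is obtained from here by integration.\<close>

lemma wp'_periodic: "wp'_on UNIV (z + om l) = wp'_on UNIV z"
proof -
  have "bij_betw (\<lambda>k. k + l) UNIV UNIV"
    by (rule bij_betw_byWitness[of _ "\<lambda>k. k - l"]) auto
  from infsum_reindex_bij_betw[OF this, of "\<lambda>k. - 2 / (z + om l - om k) ^ 3"]
  show ?thesis by (simp add: wp'_on_def om_add)
qed

lemma half_period_notin:
  assumes "odd (fst l) \<or> odd (snd l)" shows "om l / 2 \<notin> Lam"
proof
  assume "om l / 2 \<in> Lam"
  then obtain k where "om l / 2 = om k" by (auto simp: Lam_def)
  then have "om l = om (k + k)" by (simp add: om_add)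
  then have "l = k + k" using inj_om by (simp add: inj_eq)
  then show False using assms by (cases k) auto
qed

text \<open>The difference has derivative 0 on the complement of the lattice, which is
  connected.\<close>

lemma constant_diff:
  assumes "\<And>z. z \<notin> Lam \<Longrightarrow> (f has_field_derivative f' z) (at z)" 
    and "\<And>z. z \<notin> Lam \<Longrightarrow> f' (z + om l) = f' z"
  obtains c where "\<And>z. z \<notin> Lam \<Longrightarrow> f (z + om l) - f z = c"
proof -
  have d: "((\<lambda>z. f (z + om l) - f z) has_field_derivative 0) (at z)" if "z \<notin> Lam" for z
  proof -
    have "((\<lambda>z. f (z + om l)) has_field_derivative f' z) (at z)"
      using assms(1)[of "z + om l"] assms(2)[of z] that by (simp add: DERIV_shift)
    from DERIV_diff[OF this assms(1)[OF that]] show ?thesis by simp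
  qed
  then have "continuous_on (- Lam) (\<lambda>z. f (z + om l) - f z)"
    by (intro DERIV_continuous_on[of _ _ "\<lambda>_. 0"]) (auto intro: has_field_derivative_at_within)
  from DERIV_zero_connected_constant[OF connected_compl_Lam open_compl_Lam finite.emptyI this] d
  obtain c where "\<And>z. z \<in> - Lam \<Longrightarrow> f (z + om l) - f z = c" by auto
  then show thesis using that by auto
qed

text \<open>The constant is evaluated at minus the half period, where evenness makes it 0. An odd
  coordinate of \<open>l\<close> keeps the half period off the lattice.\<close>

lemma wp_periodic_aux:
  assumes "odd (fst l) \<or> odd (snd l)" "z \<notin> Lam" shows "wp (z + om l) = wp z"
proof -
  obtain c where c: "\<And>z. z \<notin> Lam \<Longrightarrow> wp (z + om l) - wp z = c"
    using constant_diff[OF wp_deriv] wp'_periodic by blast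
  note h = half_period_notin[OF assms(1)]
  have "c = wp (- (om l / 2) + om l) - wp (- (om l / 2))" using c[of "- (om l / 2)"] h by simp
  also have "- (om l / 2) + om l = om l / 2" by simp
  finally have "c = 0" using h by (simp add: wp_minus)
  then show ?thesis using c assms by force
qed

text \<open>Same evaluation at minus the half period; now oddness doubles the value instead of
  cancelling it.\<close>

lemma zeta_quasiperiodic_aux:
  assumes "odd (fst l) \<or> odd (snd l)" "z \<notin> Lam" shows "zeta (z + om l) = zeta z + 2 * zeta (om l / 2)"
proof -
  have "- wp (z + om l) = - wp z" if "z \<notin> Lam" for z
    using wp_periodic_aux assms that by simp
  from constant_diff[OF zeta_deriv this]
  obtain c where c: "\<And>z. z \<notin> Lam \<Longrightarrow> zeta (z + om l) - zeta z = c" by blast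
  note h = half_period_notin[OF assms(1)]
  have "c = zeta (- (om l / 2) + om l) - zeta (- (om l / 2))" using c[of "- (om l / 2)"] h by simp
  also have "- (om l / 2) + om l = om l / 2" by simp
  finally have "c = 2 * zeta (om l / 2)" using h by (simp add: zeta_minus)
  then show ?thesis using c[OF assms(2)] by (simp add: algebra_simps)
qed

lemma wp_periodic:
  assumes "z \<notin> Lam" shows "wp (z + p) = wp z" and "wp (z + q) = wp z"
  using wp_periodic_aux[of "(1, 0)" z] wp_periodic_aux[of "(0, 1)" z] assms by (simp_all add: om_p om_q)

lemma zeta_quasiperiodic:
  assumes "z \<notin> Lam"
  shows "zeta (z + p) = zeta z + 2 * eta" and "zeta (z + q) = zeta z + 2 * zeta (q / 2)"
  using zeta_quasiperiodic_aux[of "(1, 0)" z] zeta_quasiperiodic_aux[of "(0, 1)" z] assms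
  by (simp_all add: om_p om_q weierstrass_eta1_def)

end


section \<open>Elliptic functions and the addition theorem for the zeta function\<close>

context period_lattice begin

lemma period_multiple:
  assumes inv: "\<And>z. z + w \<in> S \<longleftrightarrow> z \<in> S" and per: "\<And>z. z \<notin> S \<Longrightarrow> f (z + w) = f z"
    and "z \<notin> S"
  shows "z + of_int m * w \<notin> S \<and> f (z + of_int m * w) = f z"
proof (induction m rule: int_induct[where k = 0])
  case (step1 i)
  then show ?case using inv[of "z + of_int i * w"] per[of "z + of_int i * w"] by (simp add: algebra_simps)
next
  case (step2 i)
  then show ?case using inv[of "z + of_int (i - 1) * w"] per[of "z + of_int (i - 1) * w"] by (simp add: algebra_simps)
qed (use assms in auto)

lemma parallelogram_cover:
  obtains a b k where "0 \<le> a" "a \<le> 1" "0 \<le> b" "b \<le> 1" "z = of_real a * p + of_real b * q + om k"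
proof -
  define \<tau> where "\<tau> = q / p"
  have q: "q = \<tau> * p" using p_nz by (simp add: \<tau>_def)
  have t: "Im \<tau> > 0" using Im_ratio by (simp add: \<tau>_def)
  define b where "b = Im (z / p) / Im \<tau>"
  define a where "a = Re (z / p) - b * Re \<tau>"
  have "z / p = of_real a + of_real b * \<tau>" using t by (simp add: complex_eq_iff a_def b_def)
  then have "z = of_real a * p + of_real b * q" using p_nz by (simp add: q field_simps)
  then have "z = of_real (frac a) * p + of_real (frac b) * q + om (\<lfloor>a\<rfloor>, \<lfloor>b\<rfloor>)"
    by (simp add: om_def frac_def algebra_simps)
  then show thesis using frac_lt_1[of a] frac_lt_1[of b] by (intro that[of "frac a" "frac b"]) auto
qed

lemma mem_translate_Lam: "z \<in> (+) b ` Lam \<longleftrightarrow> z - b \<in> Lam"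
  by (auto simp: image_iff intro!: bexI[of _ "z - b"])

section \<open>Liouville's theorem for functions singular on finitely many cosets of the
  lattice\<close>

text \<open>This is a neighbourhood of \<open>s\<close> in which no other point of the union is
  left, which makes every singularity isolated.\<close>

lemma open_punctured_translates:
  assumes "finite B" shows "open (- ((\<Union>b\<in>B. (+) b ` Lam) - {s}))"
proof -
  have "(\<Union>b\<in>B. (+) b ` Lam) - {s} = (\<Union>b\<in>B. (+) b ` om ` {k. b + om k \<noteq> s})"
    unfolding Lam_def by auto
  then show ?thesis using assms closed_om_image
    by (auto simp del: Compl_Diff_eq intro!: open_Compl closed_UN closed_translation)
qed

lemma eventually_notin_translates:
  assumes "finite B" shows "\<forall>\<^sub>F w in at s. w \<notin> (\<Union>b\<in>B. (+) b ` Lam)"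
  by (rule eventually_mono[OF eventually_at_in_open[OF open_punctured_translates[OF assms, of s], of s]]) auto

text \<open>Finite limits at the representatives in \<open>B\<close> spread to all singular points
  by periodicity. The singularities are then removable, and the entire extension is bounded because
  it takes all its values on a compact period parallelogram.\<close>

lemma elliptic_constant:
  assumes B: "finite B" and S: "S = (\<Union>b\<in>B. (+) b ` Lam)"
    and holo: "f holomorphic_on - S"
    and perp: "\<And>z. z \<notin> S \<Longrightarrow> f (z + p) = f z" and perq: "\<And>z. z \<notin> S \<Longrightarrow> f (z + q) = f z"
    and lim: "\<And>b. b \<in> B \<Longrightarrow> \<exists>c. f \<midarrow>b\<rightarrow> c"
  obtains c where "\<And>z. z \<notin> S \<Longrightarrow> f z = c"
proof -
  have mem: "z \<in> S \<longleftrightarrow> (\<exists>b\<in>B. z - b \<in> Lam)" for z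
    unfolding S by (simp add: mem_translate_Lam)
  have inv: "z + om k \<in> S \<longleftrightarrow> z \<in> S" for z k
    using Lam_periodic[of "z - b" k for b] by (simp add: mem add_diff_eq[symmetric] diff_add_eq)
  have per: "f (z + om k) = f z" if "z \<notin> S" for z k
  proof -
    have "z + of_int (fst k) * p \<notin> S \<and> f (z + of_int (fst k) * p) = f z"
      using inv[of _ "(1, 0)"] perp that by (intro period_multiple) (auto simp: om_p)
    moreover from this have "f (z + of_int (fst k) * p + of_int (snd k) * q) = f (z + of_int (fst k) * p)"
      using inv[of _ "(0, 1)"] perq by (intro period_multiple[where S = S, THEN conjunct2]) (auto simp: om_q)
    ultimately show ?thesis by (simp add: om_def add.assoc)
  qed
  note op = open_punctured_translates[OF B, folded S]
  note ev = eventually_notin_translates[OF B, folded S]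
  have opS: "open (- S)"
    using B closed_om_image unfolding S Lam_def by (auto intro!: open_Compl closed_UN closed_translation)
  have limS: "\<exists>c. f \<midarrow>s\<rightarrow> c" for s
  proof (cases "s \<in> S")
    case True
    then obtain b k where bk: "b \<in> B" "s = b + om k" unfolding S Lam_def by auto
    obtain c where c: "f \<midarrow>b\<rightarrow> c" using lim bk by blast
    have "(\<lambda>w. f (w + - om k)) \<midarrow>b - - om k\<rightarrow> c" by (rule LIM_offset[OF c])
    then have "(\<lambda>w. f (w - om k)) \<midarrow>s\<rightarrow> c" by (simp add: bk)
    moreover have "\<forall>\<^sub>F w in at s. f (w - om k) = f w"
      using ev[of s] by eventually_elim (metis per diff_add_cancel inv)
    ultimately have "f \<midarrow>s\<rightarrow> c" by (rule Lim_transform_eventually)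
    then show ?thesis by blast
  next
    case False
    then have "f analytic_on {s}"
      using holomorphic_on_imp_analytic_at[OF holo opS] by simp
    then show ?thesis using analytic_at_imp_isCont isContD by blast
  qed
  \<comment> \<open>The values of \<open>f\<close> on \<open>S\<close> are arbitrary;
    \<open>g\<close> replaces them by the limits and is therefore continuous everywhere.\<close>
  define g where "g = (\<lambda>z. Lim (at z) f)"
  have lim_g: "f \<midarrow>z\<rightarrow> g z" for z
    using limS[of z] tendsto_Lim[OF trivial_limit_at] unfolding g_def by blast
  have gf: "g z = f z" if "z \<notin> S" for z
  proof -
    have "f analytic_on {z}" using that holomorphic_on_imp_analytic_at[OF holo opS] by simp
    then have "f \<midarrow>z\<rightarrow> f z" using analytic_at_imp_isCont isContD by blast
    then show ?thesis using lim_g LIM_unique by blast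
  qed
  have g_lim: "g \<midarrow>z\<rightarrow> g z" for z
  proof (rule Lim_transform_eventually[OF lim_g])
    show "\<forall>\<^sub>F w in at z. f w = g w" using ev[of z] by eventually_elim (simp add: gf)
  qed
  then have g_cont: "continuous_on A g" for A
    by (simp add: continuous_at_imp_continuous_on isCont_def)
  have "g holomorphic_on - (S - {s})" for s
  proof (rule no_isolated_singularity[OF g_cont _ op, of _ "{s}"])
    have "f holomorphic_on - (S - {s}) - {s}" by (rule holomorphic_on_subset[OF holo]) auto
    then show "g holomorphic_on - (S - {s}) - {s}" by (rule holomorphic_transform) (auto simp: gf)
  qed simp
  then have "g field_differentiable at s" for s
    using holomorphic_on_imp_differentiable_at[OF _ op] by blast
  then have g_holo: "g holomorphic_on UNIV"
    by (simp add: holomorphic_on_def field_differentiable_at_within)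
  have g_per: "g (z + om k) = g z" for z k
  proof -
    have "(\<lambda>w. g (w + om k)) \<midarrow>z\<rightarrow> g (z + om k)"
      using LIM_offset[OF g_lim[of "z + om k"], of "om k"] by simp
    moreover have "\<forall>\<^sub>F w in at z. g (w + om k) = g w"
      using ev[of z] by eventually_elim (simp add: gf inv per)
    ultimately have "g \<midarrow>z\<rightarrow> g (z + om k)" by (rule Lim_transform_eventually)
    then show ?thesis using g_lim LIM_unique by blast
  qed
  define K where "K = (\<lambda>(a, b). of_real a * p + of_real b * q) ` ({0..1} \<times> {0..1})"
  have "compact K" unfolding K_def
    by (intro compact_continuous_image compact_Times continuous_intros) (auto simp: case_prod_unfold intro!: continuous_intros)
  then have "bounded (g ` K)"
    by (intro compact_imp_bounded compact_continuous_image continuous_on_subset[OF g_cont]) auto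
  moreover have "range g \<subseteq> g ` K"
  proof safe
    fix z
    obtain a b k where "0 \<le> a" "a \<le> 1" "0 \<le> b" "b \<le> 1" and z: "z = of_real a * p + of_real b * q + om k"
      by (rule parallelogram_cover)
    then have "of_real a * p + of_real b * q \<in> K" by (auto simp: K_def)
    then show "g z \<in> g ` K" using g_per z by auto
  qed
  ultimately have "g constant_on UNIV"
    using Liouville_theorem[OF g_holo] bounded_subset by blast
  then obtain c where "\<And>z. g z = c" by (auto simp: constant_on_def)
  then show thesis using that gf by metis
qed

section \<open>The addition theorem\<close>

lemma zeta_on_0: "zeta_on A 0 = 0" and wp_on_0: "wp_on A 0 = 0"
proof -
  have "zterm k 0 = 0" "pterm k 0 = 0" for k by (auto simp: zterm_def pterm_def)
  then show "zeta_on A 0 = 0" "wp_on A 0 = 0" by (auto simp: zeta_on_def wp_on_def)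
qed

text \<open>With \<open>b\<close> fixed, the difference \<open>F\<close> of the two sides is
  elliptic in the first argument; quasi-period increments cancel in the bracket. Its possible poles
  are 0 and \<open>- b\<close> modulo the lattice. It tends to 0 at 0, which makes both the
  singularity removable and the constant 0.\<close>

lemma zeta_addition:
  assumes abc: "a + b + c = 0" and notin: "a \<notin> Lam" "b \<notin> Lam" "c \<notin> Lam"
  shows "(zeta a + zeta b + zeta c)\<^sup>2 = wp a + wp b + wp c"
proof -
  define F where "F = (\<lambda>a. (zeta a + zeta b - zeta (a + b))\<^sup>2 - wp a - wp b - wp (a + b))"
  define S where "S = (\<Union>d\<in>{0, - b}. (+) d ` Lam)"
  have S: "z \<in> S \<longleftrightarrow> z \<in> Lam \<or> z + b \<in> Lam" for z
    using mem_translate_Lam[of z "- b"] mem_translate_Lam[of z 0] by (simp add: S_def)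
  have d: "zeta field_differentiable at z" "wp field_differentiable at z" if "z \<notin> Lam" for z
    using zeta_deriv[OF that] wp_deriv[OF that] field_differentiable_def by blast+
  have sh: "(\<lambda>w. zeta (w + b)) field_differentiable at z" "(\<lambda>w. wp (w + b)) field_differentiable at z" if "z + b \<notin> Lam" for z
    using zeta_deriv[OF that] wp_deriv[OF that] unfolding field_differentiable_def DERIV_shift by blast+
  have "F field_differentiable at z" if "z \<notin> S" for z
    using that unfolding F_def S
    by (intro derivative_intros d sh field_differentiable_diff field_differentiable_add field_differentiable_power) (auto simp: notin)
  then have holo: "F holomorphic_on - S"
    by (auto simp: holomorphic_on_def intro: field_differentiable_at_within)
  have per: "F (z + p) = F z" "F (z + q) = F z" if "z \<notin> S" for z
    using that zeta_quasiperiodic[of z] zeta_quasiperiodic[of "z + b"] wp_periodic[of z] wp_periodic[of "z + b"]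
    by (simp_all add: F_def S add_ac add_diff_eq)
  let ?A = "UNIV - {(0, 0)} :: (int \<times> int) set"
  have z0: "0 \<notin> om ` ?A" by (auto simp: image_iff)
  \<comment> \<open>\<open>G\<close> is the bracket of \<open>F\<close> without its pole
    \<open>1 / z\<close>. It vanishes at 0 with derivative \<open>wp b\<close>, so in
    \<open>(1 / z + G)^2\<close> the square of the pole cancels against \<open>wp z\<close> and the
    mixed term tends to \<open>2 * wp b\<close>, which the remaining two \<open>wp\<close> terms
    compensate.\<close>
  define G where "G = (\<lambda>z. zeta_on ?A z + zeta b - zeta (z + b))"
  have "((\<lambda>z. zeta (z + b)) has_field_derivative - wp b) (at 0)"
    using zeta_deriv[of "0 + b"] notin unfolding DERIV_shift by simp
  then have G': "(G has_field_derivative wp b) (at 0)"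
    unfolding G_def using zeta_on(1)[OF z0] by (auto intro!: derivative_eq_intros simp: wp_on_0)
  have G0: "G 0 = 0" by (simp add: G_def zeta_on_0)
  have "((\<lambda>z. G z / z) \<longlongrightarrow> wp b) (at 0)" using G' by (simp add: has_field_derivative_iff G0)
  moreover have "G \<midarrow>0\<rightarrow> 0" using G' G0 by (metis DERIV_isCont isContD)
  moreover have "wp_on ?A \<midarrow>0\<rightarrow> 0" using wp_on[OF z0] wp_on_0 by (metis DERIV_isCont isContD)
  moreover have "(\<lambda>z. wp (z + b)) \<midarrow>0\<rightarrow> wp b"
    using wp_deriv[of "0 + b"] notin DERIV_isCont isContD unfolding DERIV_shift by fastforce
  ultimately have "((\<lambda>z. 2 * (G z / z) + (G z)\<^sup>2 - wp_on ?A z - wp b - wp (z + b)) \<longlongrightarrow> 2 * wp b + 0\<^sup>2 - 0 - wp b - wp b) (at 0)"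
    by (intro tendsto_intros)
  moreover have "\<forall>\<^sub>F z in at 0. 2 * (G z / z) + (G z)\<^sup>2 - wp_on ?A z - wp b - wp (z + b) = F z"
    unfolding eventually_at_filter
    by (intro always_eventually allI impI)
       (simp add: F_def G_def zeta_split wp_split power2_eq_square field_simps)
  ultimately have "F \<midarrow>0\<rightarrow> 2 * wp b + 0\<^sup>2 - 0 - wp b - wp b" by (rule Lim_transform_eventually)
  then have F0: "F \<midarrow>0\<rightarrow> 0" by simp
  \<comment> \<open>The reflection exchanges \<open>z\<close> with \<open>- (z + b)\<close> and
    carries the singularity at \<open>- b\<close> to the one at 0, so no second expansion is
    necessary.\<close>
  have refl: "F (- z - b) = F z" if "z \<notin> S" for z
  proof -
    have "zeta (- z - b) = - zeta (z + b)" "wp (- z - b) = wp (z + b)"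
      using that zeta_minus[of "z + b"] wp_minus[of "z + b"] by (simp_all add: S)
    then show ?thesis using that zeta_minus[of z] wp_minus[of z] by (simp add: F_def S algebra_simps)
  qed
  have ev: "\<forall>\<^sub>F w in at s. w \<notin> S" for s
    unfolding S_def by (rule eventually_notin_translates) auto
  have "filterlim (\<lambda>z. - z - b) (at 0) (at (- b))"
  proof (rule filterlim_atI)
    have "- z - b \<noteq> 0" if "z \<noteq> - b" for z using that by (metis eq_iff_diff_eq_0 minus_minus)
    then show "\<forall>\<^sub>F z in at (- b). - z - b \<noteq> 0" by (auto simp: eventually_at_filter)
  qed (auto intro!: tendsto_eq_intros)
  from filterlim_compose[OF F0 this] have "(\<lambda>z. F (- z - b)) \<midarrow>- b\<rightarrow> 0" .
  moreover have "\<forall>\<^sub>F z in at (- b). F (- z - b) = F z"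
    using ev[of "- b"] by eventually_elim (rule refl)
  ultimately have Fb: "F \<midarrow>- b\<rightarrow> 0" by (rule Lim_transform_eventually)
  obtain C where C: "\<And>z. z \<notin> S \<Longrightarrow> F z = C"
    using elliptic_constant[of "{0, - b}" S F] S_def holo per F0 Fb by (metis finite.emptyI finite.insertI insertE singletonD)
  have "\<forall>\<^sub>F z in at 0. F z = C" using ev[of 0] by eventually_elim (rule C)
  then have "F \<midarrow>0\<rightarrow> C" by (simp add: tendsto_eventually)
  then have "C = 0" using F0 LIM_unique by blast
  have c: "c = - (a + b)" using abc by (metis add_eq_0_iff)
  then have ab: "a + b \<notin> Lam" using notin Lam_minus[of "a + b"] by metis
  then have "F a = 0" using C \<open>C = 0\<close> notin by (simp add: S)
  then show ?thesis using zeta_minus[OF ab] wp_minus[OF ab] by (simp add: F_def c algebra_simps)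
qed

end


section \<open>The theta series\<close>

text \<open>\<open>k\<close> counts derivatives in \<open>v\<close>, each contributing one factor
  \<open>(2 * n - 1) * pi * i\<close>; all of them share one domination.\<close>

definition theta_term :: "nat \<Rightarrow> int \<Rightarrow> complex \<Rightarrow> complex \<Rightarrow> complex" where
  "theta_term k n v \<tau> = ((2 * of_int n - 1) * of_real pi * \<i>) ^ k *
     ((-1) powi n * exp (of_real pi * \<i> * \<tau> * (of_int n - 1/2)\<^sup>2)
              * exp ((2 * of_int n - 1) * of_real pi * \<i> * v))"

definition theta_deriv :: "nat \<Rightarrow> complex \<Rightarrow> complex \<Rightarrow> complex" where
  "theta_deriv k v \<tau> = \<i> * (\<Sum>\<^sub>\<infinity>n::int. theta_term k n v \<tau>)"

lemma jacobi_theta1_eq: "jacobi_theta1 v \<tau> = theta_deriv 0 v \<tau>"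
  by (simp add: jacobi_theta1_def theta_deriv_def theta_term_def)

text \<open>The first exponent is the maximum over \<open>m\<close> of
  \<open>(b + 1) * m - a * m^2\<close> with \<open>a = pi * y / 4\<close> and
  \<open>b = k * pi + pi * R\<close>. The extra 1 in \<open>b + 1\<close> saves a factor
  \<open>exp (- m)\<close>, and \<open>m = |2 * n - 1| >= |n| - 1\<close> turns it into the
  geometric second factor.\<close>

definition theta_bound :: "nat \<Rightarrow> real \<Rightarrow> real \<Rightarrow> int \<Rightarrow> real" where
  "theta_bound k R y n =
     exp ((real k * pi + pi * R + 1)\<^sup>2 / (pi * y)) * (exp 1 * exp (- 1) ^ nat \<bar>n\<bar>)"

lemma theta_bound_summable: "theta_bound k R y summable_on A"
proof -
  have "summable (\<lambda>n. exp 1 * exp (- 1 :: real) ^ n)" by (intro summable_mult summable_geometric) simp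
  then have "(\<lambda>n::int. exp 1 * exp (- 1 :: real) ^ nat \<bar>n\<bar>) summable_on UNIV"
    by (rule summable_on_int_abs) simp
  then have "theta_bound k R y summable_on UNIV"
    unfolding theta_bound_def by (rule summable_on_cmult_right)
  then show ?thesis by (rule summable_on_subset_banach) simp
qed

text \<open>Completing the square in \<open>m = \<bar>2 n - 1\<bar>\<close> beats the linear exponent.\<close>
lemma norm_theta_term_le:
  assumes v: "norm v \<le> R" and y: "0 < y" "y \<le> Im \<tau>"
  shows "norm (theta_term k n v \<tau>) \<le> theta_bound k R y n"
proof -
  define m where "m = \<bar>2 * real_of_int n - 1\<bar>"
  have m: "m \<ge> 0" by (simp add: m_def)
  have nm: "norm (2 * of_int n - 1 :: complex) = m"
    using norm_of_int[of "2 * n - 1", where 'a = complex] by (simp add: m_def)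
  define a where "a = pi * y / 4"
  define b where "b = real k * pi + pi * R"
  have a: "a > 0" using y by (simp add: a_def)
  have "norm (((2 * of_int n - 1) * of_real pi * \<i>) ^ k :: complex) = (m * pi) ^ k"
    by (simp add: norm_power norm_mult nm)
  also have "\<dots> \<le> exp (m * pi) ^ k" using m by (intro power_mono) (auto intro: order.trans[OF _ exp_ge_add_one_self])
  also have "\<dots> = exp (real k * pi * m)" by (simp flip: exp_of_nat_mult add: mult_ac)
  finally have 1: "norm (((2 * of_int n - 1) * of_real pi * \<i>) ^ k :: complex) \<le> exp (real k * pi * m)" .
  have sq: "(of_int n - 1 / 2 :: complex)\<^sup>2 = of_real (m\<^sup>2 / 4)"
    by (simp add: m_def power2_eq_square field_simps)
  have "norm (exp (of_real pi * \<i> * \<tau> * (of_int n - 1/2)\<^sup>2)) = exp (- (pi * Im \<tau> * m\<^sup>2 / 4))"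
    unfolding sq norm_exp_eq_Re by simp
  also have "\<dots> \<le> exp (- (a * m\<^sup>2))"
    using y m by (simp add: a_def mult_right_mono)
  finally have 2: "norm (exp (of_real pi * \<i> * \<tau> * (of_int n - 1/2)\<^sup>2)) \<le> exp (- (a * m\<^sup>2))" .
  have "Re ((2 * of_int n - 1) * of_real pi * \<i> * v) \<le> norm ((2 * of_int n - 1) * of_real pi * \<i> * v)"
    by (rule complex_Re_le_cmod)
  also have "\<dots> = m * pi * norm v" by (simp add: norm_mult nm)
  also have "\<dots> \<le> m * pi * R" using v m by (intro mult_left_mono) auto
  finally have 3: "norm (exp ((2 * of_int n - 1) * of_real pi * \<i> * v)) \<le> exp (m * pi * R)"
    by (simp add: norm_exp_eq_Re)
  have "norm (theta_term k n v \<tau>) \<le> exp (real k * pi * m) * (1 * exp (- (a * m\<^sup>2)) * exp (m * pi * R))"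
    unfolding theta_term_def norm_mult
    by (intro mult_mono 1 2 3 mult_nonneg_nonneg) (auto simp: norm_power_int)
  also have "\<dots> = exp (b * m - a * m\<^sup>2)"
    by (simp add: b_def algebra_simps flip: exp_add)
  also have "b * m - a * m\<^sup>2 \<le> (b + 1)\<^sup>2 / (4 * a) - m"
  proof -
    have "0 \<le> a * (m - (b + 1) / (2 * a))\<^sup>2" using a by simp
    also have "\<dots> = a * m\<^sup>2 - (b + 1) * m + (b + 1)\<^sup>2 / (4 * a)"
      using a by (simp add: field_simps power2_eq_square)
    finally show ?thesis by (simp add: algebra_simps)
  qed
  also have "(b + 1)\<^sup>2 / (4 * a) - m \<le> (b + 1)\<^sup>2 / (4 * a) + 1 - real (nat \<bar>n\<bar>)"
    unfolding m_def by linarith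
  finally have "norm (theta_term k n v \<tau>) \<le> exp ((b + 1)\<^sup>2 / (4 * a) + 1 - real (nat \<bar>n\<bar>))" by simp
  also have "\<dots> = theta_bound k R y n"
    by (simp add: theta_bound_def a_def b_def exp_add exp_diff exp_minus power_inverse field_simps flip: exp_of_nat_mult)
  finally show ?thesis .
qed

lemma theta_term_summable:
  assumes "0 < Im \<tau>" shows "(\<lambda>n. theta_term k n v \<tau>) summable_on A"
  by (rule abs_summable_summable, rule summable_on_comparison_test[OF theta_bound_summable])
     (use norm_theta_term_le[OF order_refl assms order_refl] in auto)

lemma theta_deriv_v:
  assumes "0 < Im \<tau>"
  shows "((\<lambda>v. theta_deriv k v \<tau>) has_field_derivative theta_deriv (Suc k) v \<tau>) (at v)"
proof -
  have d: "((\<lambda>v. theta_term k n v \<tau>) has_field_derivative theta_term (Suc k) n w \<tau>) (at w)" for n w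
    unfolding theta_term_def by (auto intro!: derivative_eq_intros)
  have b: "norm (theta_term k n w \<tau>) \<le> theta_bound k (norm v + 1) (Im \<tau>) n" if "w \<in> cball v 1" for n w
  proof (rule norm_theta_term_le)
    have "norm w \<le> norm v + norm (w - v)" by (metis add.commute diff_add_cancel norm_triangle_ineq)
    then show "norm w \<le> norm v + 1" using that by (auto simp: dist_norm norm_minus_commute)
  qed (use assms in auto)
  show ?thesis unfolding theta_deriv_def
    by (intro DERIV_cmult has_field_derivative_infsum(1)[OF d zero_less_one finite.emptyI theta_bound_summable b])
qed

text \<open>The heat equation, which holds term by term: \<open>pi * i * (n - 1/2)^2\<close> is
  \<open>- i / (4 * pi)\<close> times the square of \<open>(2 * n - 1) * pi * i\<close>. Domination
  on a disc around \<open>\<tau>\<close> uses half its imaginary part.\<close>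

lemma theta_deriv_tau:
  assumes "0 < Im \<tau>"
  shows "((\<lambda>\<tau>. theta_deriv 0 v \<tau>) has_field_derivative - \<i> / (4 * of_real pi) * theta_deriv 2 v \<tau>) (at \<tau>)"
proof -
  have d: "((\<lambda>\<tau>. theta_term 0 n v \<tau>) has_field_derivative - \<i> / (4 * of_real pi) * theta_term 2 n v w) (at w)" for n w
  proof -
    have "((\<lambda>\<tau>. theta_term 0 n v \<tau>) has_field_derivative of_real pi * \<i> * (of_int n - 1/2)\<^sup>2 * theta_term 0 n v w) (at w)"
      unfolding theta_term_def by (auto intro!: derivative_eq_intros)
    moreover have "of_real pi * \<i> * (of_int n - 1/2)\<^sup>2 * theta_term 0 n v w = - \<i> / (4 * of_real pi) * theta_term 2 n v w"
    proof -
      have "of_real pi * \<i> * (of_int n - 1/2)\<^sup>2 = - \<i> / (4 * of_real pi) * ((2 * of_int n - 1) * of_real pi * \<i>)\<^sup>2"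
        by (simp add: field_simps power2_eq_square)
      then show ?thesis by (simp only: theta_term_def power_0 mult_1 mult.assoc)
    qed
    ultimately show ?thesis by simp
  qed
  have b: "norm (theta_term 0 n v w) \<le> theta_bound 0 (norm v) (Im \<tau> / 2) n" if "w \<in> cball \<tau> (Im \<tau> / 2)" for n w
  proof (rule norm_theta_term_le)
    have "\<bar>Im (\<tau> - w)\<bar> \<le> Im \<tau> / 2" using that abs_Im_le_cmod[of "\<tau> - w"] by (auto simp: dist_norm)
    then show "Im \<tau> / 2 \<le> Im w" by (auto simp: abs_if split: if_splits)
  qed (use assms in auto)
  have "((\<lambda>\<tau>. \<Sum>\<^sub>\<infinity>n. theta_term 0 n v \<tau>) has_field_derivative (\<Sum>\<^sub>\<infinity>n. - \<i> / (4 * of_real pi) * theta_term 2 n v \<tau>)) (at \<tau>)"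
    by (rule has_field_derivative_infsum(1)[where r = "Im \<tau> / 2" and B = "{}", OF d _ _ theta_bound_summable b])
       (use assms in auto)
  then have "((\<lambda>\<tau>. \<Sum>\<^sub>\<infinity>n. theta_term 0 n v \<tau>) has_field_derivative - \<i> / (4 * of_real pi) * (\<Sum>\<^sub>\<infinity>n. theta_term 2 n v \<tau>)) (at \<tau>)"
    by (simp only: infsum_cmult_right')
  from DERIV_cmult[OF this, of \<i>] show ?thesis
    unfolding theta_deriv_def by (simp only: mult_ac)
qed

section \<open>Symmetries, quasi-periods and reality of the theta series\<close>

lemma infsum_int_reindex:
  fixes f :: "int \<Rightarrow> complex"
  shows "(\<Sum>\<^sub>\<infinity>n. f (n + 1)) = (\<Sum>\<^sub>\<infinity>n. f n)" and "(\<Sum>\<^sub>\<infinity>n. f (1 - n)) = (\<Sum>\<^sub>\<infinity>n. f n)"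
proof -
  have "bij_betw (\<lambda>n::int. n + 1) UNIV UNIV" by (rule bij_betw_byWitness[of _ "\<lambda>n. n - 1"]) auto
  then show "(\<Sum>\<^sub>\<infinity>n. f (n + 1)) = (\<Sum>\<^sub>\<infinity>n. f n)" by (rule infsum_reindex_bij_betw)
  have "bij_betw (\<lambda>n::int. 1 - n) UNIV UNIV" by (rule bij_betw_byWitness[of _ "\<lambda>n. 1 - n"]) auto
  then show "(\<Sum>\<^sub>\<infinity>n. f (1 - n)) = (\<Sum>\<^sub>\<infinity>n. f n)" by (rule infsum_reindex_bij_betw)
qed

lemma minus_one_powi_plus_1: "(-1 :: complex) powi (n + 1) = - ((-1) powi n)"
  by (subst power_int_add) auto

text \<open>Reindexing by \<open>1 - n\<close> negates \<open>2 * n - 1\<close>, keeps the square of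
  \<open>n - 1/2\<close> and flips the alternating sign.\<close>

lemma theta_deriv_minus: "theta_deriv k (- v) \<tau> = - ((-1) ^ k * theta_deriv k v \<tau>)"
proof -
  have "theta_term k (1 - n) (- v) \<tau> = - ((-1) ^ k) * theta_term k n v \<tau>" for n
  proof -
    have "(-1 :: complex) powi (1 - n) = - ((-1) powi n)"
      by (subst power_int_diff) (auto simp: power_int_minus_one_minus divide_inverse simp flip: power_int_minus)
    moreover have "((2 * of_int (1 - n) - 1) * of_real pi * \<i>) = (- 1 :: complex) * ((2 * of_int n - 1) * of_real pi * \<i>)"
      by (simp add: algebra_simps)
    moreover have "(of_int (1 - n) - 1 / 2 :: complex)\<^sup>2 = (of_int n - 1 / 2)\<^sup>2"
      by (simp add: power2_eq_square algebra_simps)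
    ultimately show ?thesis by (simp only: theta_term_def power_mult_distrib) simp
  qed
  then have "(\<Sum>\<^sub>\<infinity>n. theta_term k n (- v) \<tau>) = - ((-1) ^ k) * (\<Sum>\<^sub>\<infinity>n. theta_term k n v \<tau>)"
    by (subst infsum_int_reindex(2)[symmetric]) (simp add: infsum_cmult_right' infsum_uminus)
  then show ?thesis by (simp add: theta_deriv_def)
qed

lemma theta_plus_1: "theta_deriv 0 (v + 1) \<tau> = - theta_deriv 0 v \<tau>"
proof -
  have "theta_term 0 n (v + 1) \<tau> = - theta_term 0 n v \<tau>" for n
  proof -
    have "exp ((2 * of_int n - 1) * of_real pi * \<i> * (v + 1)) = 
       exp ((2 * of_int n - 1) * of_real pi * \<i> * v) * (exp (2 * of_real pi * \<i> * of_int n) * exp (- (of_real pi * \<i>)))"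
      by (simp flip: exp_add) (simp add: algebra_simps)
    also have "exp (2 * of_real pi * \<i> * of_int n) = 1"
      using exp_integer_2pi[of "of_int n"] by (simp add: mult_ac)
    also have "exp (- (of_real pi * \<i>)) = -1" by (simp add: exp_minus)
    finally show ?thesis by (simp add: theta_term_def)
  qed
  then show ?thesis by (simp add: theta_deriv_def infsum_uminus)
qed

text \<open>The shift by \<open>\<tau>\<close> completes the square from \<open>n - 1/2\<close> to
  \<open>n + 1/2\<close>, so the series moves by one index; the alternating sign gives the
  minus.\<close>

lemma theta_plus_tau: 
  "theta_deriv 0 (v + \<tau>) \<tau> = - exp (- (of_real pi * \<i> * \<tau>) - 2 * of_real pi * \<i> * v) * theta_deriv 0 v \<tau>"
proof -
  let ?e = "exp (- (of_real pi * \<i> * \<tau>) - 2 * of_real pi * \<i> * v)"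
  have "theta_term 0 n (v + \<tau>) \<tau> = - ?e * theta_term 0 (n + 1) v \<tau>" for n
  proof -
    have "exp (of_real pi * \<i> * \<tau> * (of_int n - 1/2)\<^sup>2) * exp ((2 * of_int n - 1) * of_real pi * \<i> * (v + \<tau>))
      = ?e * (exp (of_real pi * \<i> * \<tau> * (of_int (n + 1) - 1/2)\<^sup>2) * exp ((2 * of_int (n + 1) - 1) * of_real pi * \<i> * v))"
      by (simp flip: exp_add) (simp add: algebra_simps power2_eq_square)
    then show ?thesis by (simp add: theta_term_def minus_one_powi_plus_1 del: of_int_add)
  qed
  then have "(\<Sum>\<^sub>\<infinity>n. theta_term 0 n (v + \<tau>) \<tau>) = - ?e * (\<Sum>\<^sub>\<infinity>n. theta_term 0 (n + 1) v \<tau>)"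
    by (simp add: infsum_cmult_right' infsum_uminus)
  then show ?thesis using infsum_int_reindex(1)[of "\<lambda>n. theta_term 0 n v \<tau>"] by (simp add: theta_deriv_def)
qed

text \<open>For purely imaginary \<open>\<tau>\<close> conjugation of a term negates the argument.
  This sign, by oddness, cancels the one from conjugating the factor \<open>i\<close> in
  front.\<close>

lemma theta_cnj:
  assumes "Re \<tau> = 0" shows "cnj (theta_deriv 0 (of_real x) \<tau>) = theta_deriv 0 (of_real x) \<tau>"
proof -
  have "cnj \<tau> = - \<tau>" using assms by (simp add: complex_eq_iff)
  then have "cnj (theta_term 0 n (of_real x) \<tau>) = theta_term 0 n (- of_real x) \<tau>" for n
    by (simp add: theta_term_def exp_cnj)
  then have "cnj (theta_deriv 0 (of_real x) \<tau>) = - theta_deriv 0 (- of_real x) \<tau>"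
    by (simp add: theta_deriv_def flip: infsum_cnj)
  then show ?thesis by (simp add: theta_deriv_minus)
qed

text \<open>At 1/2 the exponential is \<open>(-1)^n * (- i)\<close>, which cancels the alternating
  sign and the factor \<open>i\<close>: a series of positive terms remains.\<close>

lemma theta_half_pos:
  assumes "Re \<tau> = 0" "0 < Im \<tau>" shows "0 < Re (theta_deriv 0 (1 / 2) \<tau>)"
proof -
  define g where "g = (\<lambda>n::int. exp (- (pi * Im \<tau> * (of_int n - 1 / 2)\<^sup>2)))"
  have eq: "\<i> * theta_term 0 n (1 / 2) \<tau> = of_real (g n)" for n
  proof -
    have t: "\<tau> = \<i> * of_real (Im \<tau>)" using assms by (simp add: complex_eq_iff)
    have "exp (of_real pi * \<i> * \<tau> * (of_int n - 1/2)\<^sup>2) = of_real (g n)"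
      by (subst t) (simp add: g_def exp_of_real[symmetric] mult_ac)
    moreover have "exp ((2 * of_int n - 1) * of_real pi * \<i> * (1 / 2)) = exp (of_real pi * \<i>) powi n * exp (- (of_real pi / 2 * \<i>))"
      unfolding exp_power_int exp_add[symmetric] by (rule arg_cong[of _ _ exp]) (simp add: algebra_simps)
    moreover have "exp (- (of_real pi / 2 * \<i>)) = - \<i>" 
      by (simp add: exp_eq_polar complex_eq_iff cis.ctr exp_Euler cos_of_real sin_of_real flip: of_real_divide)
    ultimately have "\<i> * theta_term 0 n (1 / 2) \<tau> = \<i> * ((-1) powi n * of_real (g n) * ((-1) powi n * - \<i>))"
      by (simp only: theta_term_def power_0 mult_1 exp_pi_i)
    also have "\<dots> = ((-1) powi n * (-1) powi n) * of_real (g n) * - (\<i> * \<i>)" by (simp only: mult_ac mult_minus_left mult_minus_right)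
    also have "(-1 :: complex) powi n * (-1) powi n = 1"
      by (simp flip: power_int_mult_distrib)
    finally show ?thesis by simp
  qed
  have s: "(\<lambda>n. \<i> * theta_term 0 n (1 / 2) \<tau>) summable_on UNIV"
    by (intro summable_on_cmult_right theta_term_summable assms)
  have "theta_deriv 0 (1 / 2) \<tau> = (\<Sum>\<^sub>\<infinity>n. \<i> * theta_term 0 n (1 / 2) \<tau>)"
    by (simp add: theta_deriv_def infsum_cmult_right')
  then have "Re (theta_deriv 0 (1 / 2) \<tau>) = (\<Sum>\<^sub>\<infinity>n. g n)"
    using infsum_Re[OF s] by (simp only: eq Re_complex_of_real)
  moreover have "g summable_on UNIV"
    using summable_on_Re[OF s] by (simp only: eq Re_complex_of_real)
  then have "sum g {0} \<le> (\<Sum>\<^sub>\<infinity>n. g n)"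
    by (intro finite_sum_le_infsum) (auto simp: g_def)
  then have "0 < (\<Sum>\<^sub>\<infinity>n. g n)" by (rule less_le_trans[rotated]) (simp add: g_def)
  ultimately show ?thesis by simp
qed


section \<open>Zeros and logarithmic derivative of the theta function\<close>

text \<open>The infinite q-Pochhammer symbol \<open>(w; Q)\<close>.\<close>

definition qprod :: "complex \<Rightarrow> complex \<Rightarrow> complex" where
  "qprod Q w = (\<Prod>n. 1 - Q ^ n * w)"

context
  fixes Q :: complex
  assumes Q: "norm Q < 1"
begin

lemma convergent_qprod: "convergent_prod (\<lambda>n. 1 - Q ^ n * w)"
proof -
  have "summable (\<lambda>n. norm Q ^ n * norm w)" using Q by (intro summable_mult2 summable_geometric) simp
  then show ?thesis
    by (intro abs_convergent_prod_imp_convergent_prod summable_imp_abs_convergent_prod)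
       (simp add: norm_mult norm_power)
qed

lemma qprod_step: "qprod Q w = (1 - w) * qprod Q (Q * w)"
proof -
  have "(\<lambda>n. 1 - Q ^ n * w) has_prod ((\<Prod>k<1. 1 - Q ^ k * w) * (\<Prod>k. 1 - Q ^ (k + 1) * w))"
    by (rule has_prod_ignore_initial_segment'[OF convergent_qprod])
  then have "qprod Q w = (\<Prod>k<1. 1 - Q ^ k * w) * (\<Prod>k. 1 - Q ^ (k + 1) * w)"
    unfolding qprod_def by (metis has_prod_unique)
  then show ?thesis by (simp add: qprod_def mult_ac)
qed

lemma qprod_eq_0_iff: "qprod Q w = 0 \<longleftrightarrow> (\<exists>n. Q ^ n * w = 1)"
  using has_prod_eq_0_iff[OF convergent_prod_has_prod[OF convergent_qprod[of w]]]
  by (auto simp: qprod_def image_iff)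

lemma qprod_holomorphic: "qprod Q holomorphic_on UNIV"
proof (rule holomorphic_uniform_sequence)
  show "(\<lambda>w. \<Prod>n<N. 1 - Q ^ n * w) holomorphic_on UNIV" for N by (intro holomorphic_intros)
  have "uniform_limit (cball x 1) (\<lambda>N w. \<Prod>n<N. 1 - Q ^ n * w) (qprod Q) sequentially" for x
  proof -
    let ?C = "cball x 1"
    have "uniformly_convergent_on ?C (\<lambda>N w. \<Sum>n<N. norm ((1 - Q ^ n * w) - 1))"
    proof (rule Weierstrass_m_test')
      show "summable (\<lambda>n. norm Q ^ n * (norm x + 1))"
        using Q by (intro summable_mult2 summable_geometric) simp
      fix n w assume "w \<in> ?C"
      then have "norm w \<le> norm x + 1"
        using norm_triangle_sub[of w x] by (simp add: dist_norm norm_minus_commute)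
      then show "norm (norm ((1 - Q ^ n * w) - 1)) \<le> norm Q ^ n * (norm x + 1)"
        by (simp add: norm_mult norm_power mult_left_mono)
    qed
    then have "uniformly_convergent_on ?C (\<lambda>N w. \<Prod>n<N. 1 - Q ^ n * w)"
      by (intro uniformly_convergent_on_prod') (auto intro!: continuous_intros)
    then have "uniform_limit ?C (\<lambda>N w. \<Prod>n<N. 1 - Q ^ n * w) (\<lambda>w. lim (\<lambda>N. \<Prod>n<N. 1 - Q ^ n * w)) sequentially"
      by (simp add: uniformly_convergent_uniform_limit_iff)
    moreover have "lim (\<lambda>N. \<Prod>n<N. 1 - Q ^ n * w) = qprod Q w" for w
      unfolding qprod_def
      using has_prod_imp_tendsto'[OF convergent_prod_has_prod[OF convergent_qprod[of w]]] limI by blast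
    ultimately show ?thesis by simp
  qed
  then show "\<exists>d>0. cball x d \<subseteq> UNIV \<and> uniform_limit (cball x d) (\<lambda>N w. \<Prod>n<N. 1 - Q ^ n * w) (qprod Q) sequentially" for x
    by (intro exI[of _ 1]) auto
qed auto

lemma qprod_field_differentiable: "(\<lambda>z. qprod Q (f z)) field_differentiable at z" if "f field_differentiable at z"
proof -
  have "qprod Q field_differentiable at (f z)"
    using qprod_holomorphic holomorphic_on_imp_differentiable_at open_UNIV by blast
  from field_differentiable_compose[OF that this] show ?thesis by (simp add: o_def)
qed

end

section \<open>The theta function of a rectangular lattice against its product\<close>

locale rectangular_lattice = period_lattice +
  assumes Re_ratio: "Re (q / p) = 0"
begin

text \<open>The argument is rescaled to the period \<open>p\<close>; by the chain rule the division
  by \<open>p ^ k\<close> makes \<open>th (Suc k)\<close> the derivative of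
  \<open>th k\<close>.\<close>

definition th :: "nat \<Rightarrow> complex \<Rightarrow> complex" where
  "th k z = theta_deriv k (z / p) (q / p) / p ^ k"

lemma th_deriv: "(th k has_field_derivative th (Suc k) z) (at z)"
proof -
  have "((\<lambda>z. theta_deriv k (z / p) (q / p)) has_field_derivative theta_deriv (Suc k) (z / p) (q / p) * (1 / p)) (at z)"
    by (rule DERIV_chain2[OF theta_deriv_v[OF Im_ratio]]) (auto intro!: derivative_eq_intros simp: p_nz)
  from DERIV_cdivide[OF this, of "p ^ k"] show ?thesis unfolding th_def by simp
qed

lemma th_minus: "th k (- z) = - ((-1) ^ k * th k z)"
  by (simp add: th_def theta_deriv_minus)

lemma th_0 [simp]: "th 0 0 = 0" using th_minus[of 0 0] by simp

lemma th_holomorphic: "th k holomorphic_on A"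
  using th_deriv by (meson field_differentiable_at_within field_differentiable_def holomorphic_on_def)

definition mult_q :: "complex \<Rightarrow> complex" where
  "mult_q z = - exp (- (of_real pi * \<i> * (q / p)) - 2 * of_real pi * \<i> * (z / p))"

lemma th_plus_p: "th 0 (z + p) = - th 0 z"
  using theta_plus_1[of "z / p" "q / p"] p_nz by (simp add: th_def add_divide_distrib)

lemma th_plus_q: "th 0 (z + q) = mult_q z * th 0 z"
  using theta_plus_tau[of "z / p" "q / p"] by (simp add: th_def add_divide_distrib mult_q_def)

definition wexp :: "complex \<Rightarrow> complex" where "wexp z = exp (2 * of_real pi * \<i> * (z / p))"

lemma wexp_nz [simp]: "wexp z \<noteq> 0" by (simp add: wexp_def)
lemma wexp_0 [simp]: "wexp 0 = 1" by (simp add: wexp_def)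
lemma wexp_add: "wexp (z + u) = wexp z * wexp u"
  by (simp add: wexp_def add_divide_distrib distrib_left exp_add)
lemma wexp_mult: "wexp (of_nat n * z) = wexp z ^ n"
  by (simp add: wexp_def mult_ac flip: exp_of_nat_mult)
lemma wexp_minus: "wexp (- z) = 1 / wexp z"
  by (simp add: wexp_def exp_minus divide_inverse)
lemma wexp_p: "wexp p = 1" using p_nz by (simp add: wexp_def)

lemma norm_wexp_q: "norm (wexp q) < 1"
proof -
  have "Re (2 * of_real pi * \<i> * u) = - (2 * pi * Im u)" for u by simp
  from this[of "q / p"] have "Re (2 * of_real pi * \<i> * (q / p)) = - (2 * pi * Im (q / p))" .
  then show ?thesis using Im_ratio by (simp add: wexp_def norm_exp_eq_Re)
qed

lemma wexp_deriv: "(wexp has_field_derivative 2 * of_real pi * \<i> / p * wexp z) (at z)"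
  unfolding wexp_def by (auto intro!: derivative_eq_intros simp: p_nz)

lemma wexp_eq_1: 
  assumes "wexp z = 1" shows "\<exists>n. z = om (n, 0)"
proof -
  define u where "u = z / p"
  have "exp (2 * of_real pi * \<i> * u) = 1" using assms by (simp add: wexp_def u_def)
  then obtain n :: int where "Im u = 0" "Re u = of_int n" by (auto simp: exp_eq_1)
  then have "u = of_int n" by (simp add: complex_eq_iff)
  then have "z = om (n, 0)" using p_nz by (simp add: om_def u_def field_simps)
  then show ?thesis by blast
qed

abbreviation "Q \<equiv> wexp q"

text \<open>
  Up to a constant and the factor $e^{-\pi i z/p}$ this is the product side of the Jacobi triple
  product.
\<close>

definition triple_prod :: "complex \<Rightarrow> complex" where
  "triple_prod z = qprod Q (wexp z) * qprod Q (Q / wexp z)"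

text \<open>The factor turns the odd exponents \<open>2 * n - 1\<close> into even ones, so that the
  result is \<open>p\<close>-periodic and has the same multiplier under \<open>q\<close> as
  \<open>triple_prod\<close>.\<close>

definition theta_shift :: "complex \<Rightarrow> complex" where
  "theta_shift z = exp (of_real pi * \<i> * (z / p)) * th 0 z"

lemma triple_prod_plus_p: "triple_prod (z + p) = triple_prod z" by (simp add: triple_prod_def wexp_add wexp_p)

text \<open>The shift by \<open>q\<close> moves a factor from one product to the other: the first
  loses \<open>1 - wexp z\<close>, the second gains
  \<open>1 - 1 / wexp z = - (1 - wexp z) / wexp z\<close>.\<close>

lemma triple_prod_plus_q: "triple_prod (z + q) = - (triple_prod z / wexp z)"
proof -
  have "wexp z * qprod Q (1 / wexp z) = (wexp z - 1) * qprod Q (Q / wexp z)"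
    using qprod_step[OF norm_wexp_q, of "1 / wexp z"] by (simp add: field_simps)
  then have "qprod Q (1 / wexp z) = (wexp z - 1) * qprod Q (Q / wexp z) / wexp z" by (simp add: field_simps)
  then have "triple_prod (z + q) = qprod Q (Q * wexp z) * (wexp z - 1) * qprod Q (Q / wexp z) / wexp z"
    by (simp add: triple_prod_def wexp_add mult.commute)
  also have "\<dots> = - ((1 - wexp z) * qprod Q (Q * wexp z) * qprod Q (Q / wexp z) / wexp z)"
    by (simp add: algebra_simps diff_divide_distrib)
  also have "\<dots> = - (triple_prod z / wexp z)" by (simp add: triple_prod_def flip: qprod_step[OF norm_wexp_q])
  finally show ?thesis .
qed

text \<open>A vanishing factor of the first product puts \<open>z\<close> at a lattice point with
  coefficient of \<open>q\<close> at most 0, one of the second at a lattice point with positive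
  coefficient.\<close>

lemma triple_prod_nonzero:
  assumes "z \<notin> Lam" shows "triple_prod z \<noteq> 0"
proof
  assume "triple_prod z = 0"
  then have "(\<exists>n. Q ^ n * wexp z = 1) \<or> (\<exists>n. Q ^ n * (Q / wexp z) = 1)"
    by (simp add: triple_prod_def qprod_eq_0_iff[OF norm_wexp_q])
  moreover have "z \<in> Lam" if "Q ^ n * wexp z = 1" for n
  proof -
    have "wexp (of_nat n * q + z) = 1" using that by (simp add: wexp_add wexp_mult)
    then obtain m where "of_nat n * q + z = om (m, 0)" using wexp_eq_1 by blast
    then have "z = om (m, - int n)" by (simp add: om_def algebra_simps)
    then show ?thesis by (simp add: Lam_def)
  qed
  moreover have "z \<in> Lam" if "Q ^ n * (Q / wexp z) = 1" for n
  proof -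
    have "wexp (of_nat (Suc n) * q + - z) = 1"
      using that unfolding wexp_add wexp_mult wexp_minus by (simp add: mult.commute)
    then obtain m where "of_nat (Suc n) * q + - z = om (m, 0)" using wexp_eq_1 by blast
    then have "z = om (- m, int (Suc n))" by (simp add: om_def algebra_simps)
    then show ?thesis by (simp add: Lam_def)
  qed
  ultimately show False using assms by blast
qed

lemma theta_shift_plus_p: "theta_shift (z + p) = theta_shift z"
  by (simp add: theta_shift_def th_plus_p add_divide_distrib p_nz distrib_left exp_add)

lemma theta_shift_plus_q: "theta_shift (z + q) = - (theta_shift z / wexp z)"
proof -
  have "exp (of_real pi * \<i> * ((z + q) / p)) * mult_q z = - (exp (of_real pi * \<i> * (z / p)) * wexp (- z))"
    by (simp add: mult_q_def wexp_def flip: exp_add) (simp add: algebra_simps add_divide_distrib)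
  then show ?thesis by (simp add: theta_shift_def th_plus_q wexp_minus mult.assoc[symmetric]) 
qed

lemma triple_prod_factor: "triple_prod z = (1 - wexp z) * (qprod Q (Q * wexp z) * qprod Q (Q / wexp z))"
  using qprod_step[OF norm_wexp_q, of "wexp z"] by (simp add: triple_prod_def mult.assoc)

text \<open>The zero at 0 is simple: it comes from \<open>1 - wexp z\<close> alone, because no
  positive power of \<open>Q\<close> equals 1.\<close>

lemma triple_prod_deriv_0:
  obtains d where "d \<noteq> 0" "(triple_prod has_field_derivative d) (at 0)"
proof -
  define K where "K = (\<lambda>z. qprod Q (Q * wexp z) * qprod Q (Q / wexp z))"
  have w: "wexp field_differentiable at z" for z
    using wexp_deriv field_differentiable_def by blast
  have "K field_differentiable at 0" unfolding K_def
    by (intro field_differentiable_mult qprod_field_differentiable[OF norm_wexp_q] field_differentiable_divide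
      field_differentiable_const w) auto
  then obtain k where k: "(K has_field_derivative k) (at 0)" by (auto simp: field_differentiable_def)
  have "((\<lambda>z. (1 - wexp z) * K z) has_field_derivative - (2 * of_real pi * \<i> / p) * K 0) (at 0)"
    by (rule derivative_eq_intros k wexp_deriv refl)+ simp
  moreover have "triple_prod = (\<lambda>z. (1 - wexp z) * K z)" using triple_prod_factor by (auto simp: K_def)
  moreover have "Q ^ n * Q \<noteq> 1" for n
  proof
    assume "Q ^ n * Q = 1"
    then have "norm Q ^ Suc n = 1" by (metis norm_one norm_power power_Suc2)
    then show False using norm_wexp_q power_Suc_less_one[of "norm Q" n] by (simp add: wexp_nz)
  qed
  then have "K 0 \<noteq> 0" by (simp add: K_def qprod_eq_0_iff[OF norm_wexp_q])
  ultimately show thesis using p_nz by (intro that[of "- (2 * of_real pi * \<i> / p) * K 0"]) auto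
qed

lemma triple_prod_holomorphic: "triple_prod holomorphic_on A"
proof -
  have w: "wexp field_differentiable at z" for z
    using wexp_deriv field_differentiable_def by blast
  have "triple_prod field_differentiable at z" for z unfolding triple_prod_def
    by (intro field_differentiable_mult qprod_field_differentiable[OF norm_wexp_q] field_differentiable_divide
      field_differentiable_const w) auto
  then show ?thesis by (simp add: field_differentiable_at_within holomorphic_on_def)
qed

lemma elliptic_constant_0:
  assumes "f holomorphic_on - Lam" "\<And>z. z \<notin> Lam \<Longrightarrow> f (z + p) = f z" "\<And>z. z \<notin> Lam \<Longrightarrow> f (z + q) = f z"
    and "f \<midarrow>0\<rightarrow> l"
  obtains c where "\<And>z. z \<notin> Lam \<Longrightarrow> f z = c"
  using elliptic_constant[of "{0}" Lam f] assms by auto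

lemma eventually_notin_Lam: "\<forall>\<^sub>F z in at 0. z \<notin> Lam"
  using eventually_notin_translates[of "{0}" 0] by simp

text \<open>The quotient of \<open>theta_shift\<close> by \<open>triple_prod\<close> is elliptic,
  and its singularity at 0 is removable since both vanish there and the denominator only to first
  order. Hence it is a constant \<open>C\<close>. If \<open>C\<close> is nonzero, both claims
  follow, the second because \<open>C = th 1 0 / d\<close>.\<close>

lemma theta_zeros: "z \<notin> Lam \<Longrightarrow> th 0 z \<noteq> 0" and th_1_0: "th 1 0 \<noteq> 0"
proof -
  obtain d where d: "d \<noteq> 0" "(triple_prod has_field_derivative d) (at 0)" by (rule triple_prod_deriv_0)
  have "qprod Q 1 = 0" using qprod_step[OF norm_wexp_q, of 1] by simp
  then have prod0: "triple_prod 0 = 0" by (simp add: triple_prod_def)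
  \<comment> \<open>The limit of the quotient exists whatever the value of \<open>th 1 0\<close> is,
    so its nonvanishing is not presupposed.\<close>
  have shift_deriv: "(theta_shift has_field_derivative th 1 0) (at 0)"
    unfolding theta_shift_def by (rule derivative_eq_intros th_deriv refl | simp add: p_nz)+
  have "((\<lambda>z. theta_shift z / z) \<longlongrightarrow> th 1 0) (at 0)"
    using shift_deriv by (simp add: has_field_derivative_iff) (simp add: theta_shift_def)
  moreover have P: "((\<lambda>z. triple_prod z / z) \<longlongrightarrow> d) (at 0)"
    using d by (simp add: has_field_derivative_iff prod0)
  ultimately have "((\<lambda>z. (theta_shift z / z) / (triple_prod z / z)) \<longlongrightarrow> th 1 0 / d) (at 0)"
    using d by (intro tendsto_divide)
  moreover have "\<forall>\<^sub>F z in at 0. (theta_shift z / z) / (triple_prod z / z) = theta_shift z / triple_prod z"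
    by (auto simp: eventually_at_filter)
  ultimately have lim: "((\<lambda>z. theta_shift z / triple_prod z) \<longlongrightarrow> th 1 0 / d) (at 0)" by (rule Lim_transform_eventually)
  have "(\<lambda>z. theta_shift z / triple_prod z) holomorphic_on - Lam"
    unfolding theta_shift_def by (intro holomorphic_intros th_holomorphic triple_prod_holomorphic) (auto simp: triple_prod_nonzero p_nz)
  moreover have "theta_shift (z + p) / triple_prod (z + p) = theta_shift z / triple_prod z" "theta_shift (z + q) / triple_prod (z + q) = theta_shift z / triple_prod z" for z
    by (simp_all add: theta_shift_plus_p triple_prod_plus_p theta_shift_plus_q triple_prod_plus_q)
  ultimately obtain C where C: "\<And>z. z \<notin> Lam \<Longrightarrow> theta_shift z / triple_prod z = C"
    using elliptic_constant_0[OF _ _ _ lim] by metis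
  \<comment> \<open>At the half period the theta value has positive real part, which excludes
    \<open>C = 0\<close>.\<close>
  have "p / 2 \<notin> Lam" using half_period_notin[of "(1, 0)"] by (simp add: om_p)
  moreover have "th 0 (p / 2) \<noteq> 0"
    using theta_half_pos[OF Re_ratio Im_ratio] p_nz by (auto simp: th_def)
  ultimately have C0: "C \<noteq> 0" using C[of "p / 2"] triple_prod_nonzero[of "p / 2"] by (auto simp: theta_shift_def)
  show "th 0 z \<noteq> 0" if "z \<notin> Lam" for z using C[OF that] C0 by (auto simp: theta_shift_def)
  have "\<forall>\<^sub>F z in at 0. theta_shift z / triple_prod z = C" using eventually_notin_Lam by eventually_elim (rule C)
  then have "(\<lambda>z. theta_shift z / triple_prod z) \<midarrow>0\<rightarrow> C" by (rule tendsto_eventually)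
  then have "th 1 0 / d = C" using lim LIM_unique by blast
  then show "th 1 0 \<noteq> 0" using C0 by auto
qed

section \<open>The logarithmic derivative of theta\<close>

definition theta_logderiv :: "complex \<Rightarrow> complex" where "theta_logderiv z = th 1 z / th 0 z"
definition theta_logderiv' :: "complex \<Rightarrow> complex" where "theta_logderiv' z = th 2 z / th 0 z - (theta_logderiv z)\<^sup>2"

lemma theta_logderiv_deriv:
  assumes "z \<notin> Lam" shows "(theta_logderiv has_field_derivative theta_logderiv' z) (at z)"
proof -
  have "((\<lambda>z. th 1 z / th 0 z) has_field_derivative (th 2 z * th 0 z - th 1 z * th 1 z) / (th 0 z * th 0 z)) (at z)"
    using DERIV_divide[OF th_deriv[of 1] th_deriv[of 0] theta_zeros[OF assms]] by (simp add: numeral_2_eq_2)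
  moreover have "(th 2 z * th 0 z - th 1 z * th 1 z) / (th 0 z * th 0 z) = theta_logderiv' z"
    using theta_zeros[OF assms] by (simp add: theta_logderiv'_def theta_logderiv_def field_simps power2_eq_square)
  ultimately show ?thesis by (simp add: theta_logderiv_def[abs_def])
qed

lemma theta_logderiv_minus: "theta_logderiv (- z) = - theta_logderiv z" by (simp add: theta_logderiv_def th_minus)

lemma theta_logderiv_plus_p: "theta_logderiv (z + p) = theta_logderiv z"
proof -
  have "((\<lambda>z. th 0 (z + p)) has_field_derivative th 1 (z + p)) (at z)"
    using th_deriv[of 0 "z + p"] by (simp add: DERIV_shift)
  moreover have "((\<lambda>z. th 0 (z + p)) has_field_derivative - th 1 z) (at z)"
    unfolding th_plus_p using th_deriv[of 0 z] by (auto intro!: derivative_eq_intros)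
  ultimately have "th 1 (z + p) = - th 1 z" by (rule DERIV_unique)
  then show ?thesis by (simp add: theta_logderiv_def th_plus_p)
qed

text \<open>The logarithmic derivative of the multiplier \<open>mult_q\<close> is the constant
  \<open>- 2 * pi * i / p\<close>.\<close>

lemma theta_logderiv_plus_q: 
  assumes "z \<notin> Lam" shows "theta_logderiv (z + q) = theta_logderiv z - 2 * of_real pi * \<i> / p"
proof -
  have mq: "mult_q z \<noteq> 0" by (simp add: mult_q_def)
  have "((\<lambda>z. th 0 (z + q)) has_field_derivative th 1 (z + q)) (at z)"
    using th_deriv[of 0 "z + q"] by (simp add: DERIV_shift)
  moreover have m: "(mult_q has_field_derivative - (2 * of_real pi * \<i> / p) * mult_q z) (at z)"
    unfolding mult_q_def by (auto intro!: derivative_eq_intros simp: p_nz)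
  have "((\<lambda>z. th 0 (z + q)) has_field_derivative - (2 * of_real pi * \<i> / p) * mult_q z * th 0 z + th 1 z * mult_q z) (at z)"
    unfolding th_plus_q using DERIV_mult[OF m th_deriv[of 0 z]] by simp
  ultimately have "th 1 (z + q) = - (2 * of_real pi * \<i> / p) * mult_q z * th 0 z + th 1 z * mult_q z" by (rule DERIV_unique)
  then have "theta_logderiv (z + q) = (- (2 * of_real pi * \<i> / p) * mult_q z * th 0 z + th 1 z * mult_q z) / (mult_q z * th 0 z)"
    by (simp only: theta_logderiv_def th_plus_q)
  also have "(- (2 * of_real pi * \<i> / p) * mult_q z * th 0 z + th 1 z * mult_q z) / (mult_q z * th 0 z)
      = th 1 z / th 0 z - 2 * of_real pi * \<i> / p"
    using theta_zeros[OF assms] p_nz mq by (simp add: field_simps)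
  finally show ?thesis unfolding theta_logderiv_def .
qed

lemma theta_logderiv'_periodic:
  assumes "z \<notin> Lam" shows "theta_logderiv' (z + p) = theta_logderiv' z" and "theta_logderiv' (z + q) = theta_logderiv' z"
proof -
  have "((\<lambda>z. theta_logderiv (z + p)) has_field_derivative theta_logderiv' (z + p)) (at z)"
    using theta_logderiv_deriv[of "z + p"] assms by (simp add: DERIV_shift)
  then show "theta_logderiv' (z + p) = theta_logderiv' z"
    unfolding theta_logderiv_plus_p using theta_logderiv_deriv[OF assms] DERIV_unique by blast
  have "((\<lambda>z. theta_logderiv (z + q)) has_field_derivative theta_logderiv' (z + q)) (at z)"
    using theta_logderiv_deriv[of "z + q"] assms by (simp add: DERIV_shift)
  moreover have "((\<lambda>z. theta_logderiv (z + q)) has_field_derivative theta_logderiv' z) (at z)"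
  proof (rule has_field_derivative_transform_within_open[OF _ open_compl_Lam])
    show "((\<lambda>z. theta_logderiv z - 2 * of_real pi * \<i> / p) has_field_derivative theta_logderiv' z) (at z)"
      using theta_logderiv_deriv[OF assms] by (auto intro!: derivative_eq_intros)
  qed (use assms in \<open>auto simp: theta_logderiv_plus_q\<close>)
  ultimately show "theta_logderiv' (z + q) = theta_logderiv' z" by (rule DERIV_unique)
qed

text \<open>As the zero of theta at 0 is simple, \<open>th 0 z = z * h z\<close> with nonvanishing
  \<open>h\<close>. The logarithmic derivative is then \<open>1 / z\<close> plus a holomorphic
  \<open>G\<close>, and the double pole of its derivative cancels that of \<open>wp\<close>.\<close>

lemma theta_logderiv'_principal_part: 
  obtains l where "(\<lambda>z. wp z + theta_logderiv' z) \<midarrow>0\<rightarrow> l"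
proof -
  have "deriv (th 0) 0 = th 1 0" using th_deriv[of 0 0] by (simp add: DERIV_imp_deriv)
  then have "(deriv ^^ 1) (th 0) 0 \<noteq> 0" using th_1_0 by simp
  from holomorphic_factor_order_of_zero[OF th_holomorphic[of 0 UNIV] open_UNIV UNIV_I zero_less_one this]
  obtain h r where r: "0 < r" and h: "h holomorphic_on ball 0 r"
    and th0: "\<And>w. w \<in> ball 0 r \<Longrightarrow> th 0 w - th 0 0 = (w - 0) ^ 1 * h w"
    and hnz: "\<And>w. w \<in> ball 0 r \<Longrightarrow> h w \<noteq> 0" by (metis less_one not_less0)
  define G where "G = (\<lambda>z. deriv h z / h z)"
  have G: "G holomorphic_on ball 0 r" unfolding G_def
    by (intro holomorphic_intros h holomorphic_deriv) (auto simp: hnz)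
  have hd: "(h has_field_derivative deriv h z) (at z)" if "z \<in> ball 0 r" for z
    using h that by (simp add: holomorphic_derivI)
  have L: "theta_logderiv z = 1 / z + G z" if "z \<in> ball 0 r - {0}" for z
  proof -
    have "((\<lambda>z. z * h z) has_field_derivative h z + deriv h z * z) (at z)"
      using DERIV_mult[OF DERIV_ident hd[of z]] that by simp
    then have "(th 0 has_field_derivative h z + deriv h z * z) (at z)"
      by (rule has_field_derivative_transform_within_open[where S = "ball 0 r"]) (use that th0 in auto)
    then have "th 1 z = h z + deriv h z * z" using th_deriv[of 0 z] DERIV_unique by fastforce
    then show ?thesis using th0[of z] hnz[of z] that by (simp add: theta_logderiv_def G_def field_simps)
  qed
  have "\<forall>\<^sub>F z in at 0. z \<in> ball 0 r - {0}"
    using r by (intro eventually_at_in_open) auto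
  then have ev: "\<forall>\<^sub>F z in at 0. wp_on (UNIV - {(0, 0)}) z + deriv G z = wp z + theta_logderiv' z"
    using eventually_notin_Lam
  proof eventually_elim
    case (elim z)
    have "((\<lambda>z. 1 / z + G z) has_field_derivative - 1 / z\<^sup>2 + deriv G z) (at z)"
      using elim holomorphic_derivI[OF G open_ball, of z]
      by (auto intro!: derivative_eq_intros simp: power2_eq_square)
    then have "(theta_logderiv has_field_derivative - 1 / z\<^sup>2 + deriv G z) (at z)"
      by (rule has_field_derivative_transform_within_open[where S = "ball 0 r - {0}"]) (use elim L in auto)
    then have "theta_logderiv' z = - 1 / z\<^sup>2 + deriv G z" using theta_logderiv_deriv elim DERIV_unique by blast
    then show ?case by (simp add: wp_split)
  qed
  have "0 \<notin> om ` (UNIV - {(0, 0)})" by (auto simp: image_iff)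
  then have lim1: "wp_on (UNIV - {(0, 0)}) \<midarrow>0\<rightarrow> wp_on (UNIV - {(0, 0)}) 0"
    using wp_on DERIV_isCont isContD by blast
  have "deriv G holomorphic_on ball 0 r" using G by (simp add: holomorphic_deriv)
  then have lim2: "deriv G \<midarrow>0\<rightarrow> deriv G 0"
    using r by (metis centre_in_ball continuous_on_interior holomorphic_on_imp_continuous_on interior_open isContD open_ball)
  show thesis
    using that Lim_transform_eventually[OF tendsto_add[OF lim1 lim2] ev] by blast
qed

theorem theta_log_derivative:
  assumes "z \<notin> Lam"
  shows "theta_logderiv z = zeta z - 2 * eta * z / p" and "theta_logderiv' z = - wp z - 2 * eta / p"
proof -
  obtain l where lim: "(\<lambda>z. wp z + theta_logderiv' z) \<midarrow>0\<rightarrow> l" by (rule theta_logderiv'_principal_part)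
  have Lh: "theta_logderiv holomorphic_on - Lam"
    using theta_logderiv_deriv by (meson ComplD field_differentiable_at_within field_differentiable_def holomorphic_on_def)
  have "wp holomorphic_on - Lam"
    using wp_deriv by (meson ComplD field_differentiable_at_within field_differentiable_def holomorphic_on_def)
  then have hol: "(\<lambda>z. wp z + theta_logderiv' z) holomorphic_on - Lam" unfolding theta_logderiv'_def
    by (intro holomorphic_intros Lh th_holomorphic) (auto simp: theta_zeros)
  have "wp (z + p) + theta_logderiv' (z + p) = wp z + theta_logderiv' z" "wp (z + q) + theta_logderiv' (z + q) = wp z + theta_logderiv' z" if "z \<notin> Lam" for z
    using that by (simp_all add: wp_periodic theta_logderiv'_periodic)
  from elliptic_constant_0[OF hol this lim]
  obtain c where c: "\<And>z. z \<notin> Lam \<Longrightarrow> wp z + theta_logderiv' z = c" by blast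
  define D where "D = (\<lambda>z. zeta z - theta_logderiv z + c * z)"
  have D': "(D has_field_derivative 0) (at z)" if "z \<notin> Lam" for z
    unfolding D_def using zeta_deriv[OF that] theta_logderiv_deriv[OF that] c[OF that]
    by (auto intro!: derivative_eq_intros simp: algebra_simps)
  then have "continuous_on (- Lam) D"
    by (intro DERIV_continuous_on[of _ _ "\<lambda>_. 0"]) (auto intro: has_field_derivative_at_within)
  from DERIV_zero_connected_constant[OF connected_compl_Lam open_compl_Lam finite.emptyI this] D'
  obtain d where d: "\<And>z. z \<in> - Lam \<Longrightarrow> D z = d" by auto
  have "D (- z) = - D z" using assms by (simp add: D_def zeta_minus theta_logderiv_minus)
  then have "d = - d" using d[of z] d[of "- z"] assms by simp
  then have d0: "d = 0" by simp
  \<comment> \<open>\<open>theta_logderiv\<close> has period \<open>p\<close> exactly whereas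
    \<open>zeta\<close> gains \<open>2 * eta\<close>; this fixes \<open>c\<close>.\<close>
  have "D (z + p) = D z + (2 * eta + c * p)"
    using assms by (simp add: D_def zeta_quasiperiodic theta_logderiv_plus_p distrib_left)
  then have "2 * eta + c * p = 0" using d[of z] d[of "z + p"] assms by simp
  then have c': "c = - (2 * eta / p)" using p_nz by (simp add: field_simps add_eq_0_iff)
  have "theta_logderiv' z = c - wp z" using c[OF assms] by (simp add: eq_diff_eq add.commute)
  then show "theta_logderiv' z = - wp z - 2 * eta / p" by (simp add: c')
  show "theta_logderiv z = zeta z - 2 * eta * z / p"
    using d[of z] assms d0 c' by (simp add: D_def algebra_simps)
qed

end


section \<open>The pair potential\<close>

lemma ratio_eq:
  assumes "0 < r"
  shows "of_nat N * two_omega3 r ts t / of_real (2 * pi * r) = of_nat N * tau r ts t"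
  using assms by (simp add: two_omega3_def tau_def power2_eq_square field_simps)

locale dyson =
  fixes N :: nat and r ts t :: real and p q :: complex
  assumes N: "0 < N" and r: "0 < r" and t: "t < ts"
  defines "p \<equiv> of_real (2 * pi * r)" and "q \<equiv> of_nat N * two_omega3 r ts t"
begin

lemma ratio: "q / p = of_nat N * tau r ts t"
  unfolding p_def q_def by (rule ratio_eq[OF r])

lemma p_eq: "p = of_real (2 * pi * r)" by (simp add: p_def)

lemma div_p: "of_real y / p = of_real (y / (2 * pi * r))" by (simp add: p_eq)

lemma tau_Re_Im: "Re (of_nat N * tau r ts t) = 0" "0 < Im (of_nat N * tau r ts t)"
proof -
  have "of_nat N * tau r ts t = \<i> * of_real (real N * (ts - t) / (2 * pi * r\<^sup>2))"
    by (simp add: tau_def)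
  moreover have "0 < real N * (ts - t) / (2 * pi * r\<^sup>2)" using N r t by simp
  ultimately show "Re (of_nat N * tau r ts t) = 0" "0 < Im (of_nat N * tau r ts t)" by simp_all
qed

sublocale rectangular_lattice p q
proof
  show "p \<noteq> 0" using r by (simp add: p_eq)
  show "0 < Im (q / p)" "Re (q / p) = 0" unfolding ratio by (rule tau_Re_Im)+
qed

text \<open>The imaginary part forces the coefficient of \<open>q\<close> to be 0, and the length
  restriction then that of \<open>p\<close>. Negative \<open>y\<close> is included for the
  differences of particles in either order.\<close>

lemma real_notin_Lam:
  assumes "y \<noteq> 0" "\<bar>y\<bar> < 2 * pi * r" shows "complex_of_real y \<notin> Lam"
proof
  assume "complex_of_real y \<in> Lam"
  then obtain m n where mn: "complex_of_real y = om (m, n)" by (auto simp: Lam_def)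
  then have "of_real y / p = of_int m + of_int n * (q / p)"
    using p_nz by (simp add: om_def field_simps)
  then have eq: "of_real (y / (2 * pi * r)) = of_int m + of_int n * (q / p)" by (simp only: div_p)
  moreover have "Im (of_int m + of_int n * u) = of_int n * Im u" for u by simp
  ultimately have "of_int n * Im (q / p) = 0" by (metis Im_complex_of_real)
  then have "n = 0" using Im_ratio by simp
  with eq have "complex_of_real (y / (2 * pi * r)) = of_real (of_int m)" by simp
  then have "y / (2 * pi * r) = of_int m" by (simp only: of_real_eq_iff)
  then have y: "y = of_int m * (2 * pi * r)" using r by (simp add: field_simps)
  then have "\<bar>real_of_int m\<bar> * (2 * pi * r) < 1 * (2 * pi * r)" using assms r by (simp add: abs_mult)
  then have "\<bar>real_of_int m\<bar> < 1" by (rule mult_right_less_imp_less) (use r in simp)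
  then have "m = 0" by linarith
  then show False using y assms by simp
qed

lemma theta_eq: "jacobi_theta1 (of_real (y / (2 * pi * r))) (of_nat N * tau r ts t) = th 0 (of_real y)"
  by (simp only: jacobi_theta1_eq th_def ratio div_p power_0 div_by_1)

lemma theta_real: "th 0 (of_real y) = of_real (Re (th 0 (of_real y)))"
  using theta_cnj[OF tau_Re_Im(1), of "y / (2 * pi * r)"] theta_eq[of y]
  by (metis jacobi_theta1_eq complex_cnj_cancel_iff Reals_cnj_iff of_real_Re)

text \<open>A continuous real function without zeros on the interval that is positive at the
  midpoint \<open>pi * r\<close>, which is the half period. This keeps the theta values away from
  the branch cut of \<open>ln\<close>.\<close>

lemma theta_pos:
  assumes "y \<in> {0<..<2 * pi * r}" shows "0 < Re (th 0 (of_real y))"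
proof (rule ccontr)
  let ?f = "\<lambda>y. Re (th 0 (complex_of_real y))"
  assume "\<not> 0 < ?f y"
  moreover have "0 < ?f (pi * r)"
    using theta_half_pos[OF tau_Re_Im] theta_eq[of "pi * r"] r by (simp add: jacobi_theta1_eq)
  moreover have "continuous_on {0<..<2 * pi * r} ?f"
    by (intro continuous_on_Re continuous_on_compose2[OF holomorphic_on_imp_continuous_on[OF th_holomorphic[of 0 UNIV]]])
       (auto intro!: continuous_intros)
  then have "connected (?f ` {0<..<2 * pi * r})" by (intro connected_continuous_image) auto
  moreover have "?f (pi * r) \<in> ?f ` {0<..<2 * pi * r}" using r by (intro imageI) simp
  ultimately have "0 \<in> ?f ` {0<..<2 * pi * r}"
    using assms r by (intro connectedD_interval[of _ "?f y" "?f (pi * r)" 0]) auto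
  then obtain w where w: "w \<in> {0<..<2 * pi * r}" "?f w = 0" by auto
  then have "th 0 (complex_of_real w) = 0" using theta_real[of w] by simp
  moreover have "complex_of_real w \<notin> Lam" using w by (intro real_notin_Lam) auto
  ultimately show False using theta_zeros by blast
qed

lemma theta_nonneg_Reals:
  assumes "y \<in> {0<..<2 * pi * r}" shows "th 0 (of_real y) \<notin> \<real>\<^sub>\<le>\<^sub>0"
  using theta_pos[OF assms] by (auto simp: complex_nonpos_Reals_iff)

lemma U_deriv:
  assumes "y \<in> {0<..<2 * pi * r}"
  shows "(U N r ts t has_vector_derivative - theta_logderiv (of_real y)) (at y)"
proof -
  have "((\<lambda>z. - ln (th 0 z)) has_field_derivative - (th 1 (of_real y) / th 0 (of_real y))) (at (of_real y))"
    using th_deriv[of 0] theta_nonneg_Reals[OF assms] by (auto intro!: derivative_eq_intros simp: field_simps)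
  from has_vector_derivative_real_field[OF this]
  have "((\<lambda>y. - ln (th 0 (of_real y))) has_vector_derivative - theta_logderiv (of_real y)) (at y)"
    by (simp only: theta_logderiv_def)
  moreover have "U N r ts t = (\<lambda>y. - ln (th 0 (of_real y)))" by (rule ext) (simp only: U_def theta_eq)
  ultimately show ?thesis by simp
qed

lemma U'_eq:
  assumes "y \<in> {0<..<2 * pi * r}" shows "U' N r ts t y = - theta_logderiv (of_real y)"
  unfolding U'_def using U_deriv[OF assms] by (rule vector_derivative_at)

lemma U'_deriv:
  assumes y: "y \<in> {0<..<2 * pi * r}"
  shows "(U' N r ts t has_vector_derivative - theta_logderiv' (of_real y)) (at y)"
proof (rule has_vector_derivative_transform_within_open)
  have "((\<lambda>z. - theta_logderiv z) has_field_derivative - theta_logderiv' (of_real y)) (at (of_real y))"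
    using y by (intro derivative_intros theta_logderiv_deriv real_notin_Lam) auto
  from has_vector_derivative_real_field[OF this]
  show "((\<lambda>y. - theta_logderiv (of_real y)) has_vector_derivative - theta_logderiv' (of_real y)) (at y)" by simp
  show "open {0<..<2 * pi * r}" by simp
qed (use y in \<open>auto simp: U'_eq\<close>)

lemma U''_eq:
  assumes "y \<in> {0<..<2 * pi * r}" shows "U'' N r ts t y = - theta_logderiv' (of_real y)"
  unfolding U''_def using U'_deriv[OF assms] by (rule vector_derivative_at)

lemma U_vector_derivative:
  assumes "y \<in> {0<..<2 * pi * r}"
  shows "(U N r ts t has_vector_derivative U' N r ts t y) (at y)"
    and "(U' N r ts t has_vector_derivative U'' N r ts t y) (at y)"
  using U_deriv[OF assms] U'_deriv[OF assms] by (simp_all only: U'_eq[OF assms] U''_eq[OF assms])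

text \<open>The heat equation gives \<open>N / 2\<close> times the second logarithmic quotient
  \<open>th 2 / th 0\<close>, which is \<open>U'^2 - U''\<close> because \<open>U\<close> is minus
  the logarithm.\<close>

lemma U_deriv_t:
  assumes y: "y \<in> {0<..<2 * pi * r}"
  shows "((\<lambda>s. U N r ts s y) has_vector_derivative of_nat N / 2 * ((U' N r ts t y)\<^sup>2 - U'' N r ts t y)) (at t)"
proof -
  let ?v = "complex_of_real (y / (2 * pi * r))"
  \<comment> \<open>Time is made complex so that the holomorphic chain rule applies; the result is
    restricted to the real line afterwards.\<close>
  define T where "T = (\<lambda>s::complex. of_nat N * (\<i> * (of_real ts - s) / of_real (2 * pi * r\<^sup>2)))"
  have T: "T (of_real s) = of_nat N * tau r ts s" for s by (simp add: T_def tau_def)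
  have nz: "th 0 (of_real y) \<noteq> 0" using theta_pos[OF y] by auto
  have "(T has_field_derivative of_nat N * (- \<i> / of_real (2 * pi * r\<^sup>2))) (at (of_real t))"
    unfolding T_def using r by (auto intro!: derivative_eq_intros simp: field_simps)
  from DERIV_chain2[OF theta_deriv_tau this, of ?v]
  have "((\<lambda>s. theta_deriv 0 ?v (T s)) has_field_derivative
     - \<i> / (4 * of_real pi) * theta_deriv 2 ?v (of_nat N * tau r ts t) * (of_nat N * (- \<i> / of_real (2 * pi * r\<^sup>2)))) (at (of_real t))"
    using tau_Re_Im by (simp add: T)
  moreover have "theta_deriv 2 ?v (of_nat N * tau r ts t) = of_real ((2 * pi * r)\<^sup>2) * th 2 (of_real y)"
    using r arg_cong[OF p_eq, of "\<lambda>x. x\<^sup>2"] p_nz by (simp only: th_def div_p ratio) simp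
  \<comment> \<open>The two factors \<open>- i\<close> multiply to -1, and the radius drops out: the
    factor from the heat equation, the rescaling of \<open>v\<close> and the time derivative of the
    modulus leave \<open>- N / 2\<close>.\<close>
  moreover have "- \<i> / (4 * of_real pi) * (of_real ((2 * pi * r)\<^sup>2) * X) * (of_nat N * (- \<i> / of_real (2 * pi * r\<^sup>2)))
     = - (of_nat N / 2 * X)" for X
    using r by (simp add: field_simps power2_eq_square)
  ultimately have "((\<lambda>s. theta_deriv 0 ?v (T s)) has_field_derivative - (of_nat N / 2 * th 2 (of_real y))) (at (of_real t))"
    by (simp only:)
  moreover have "theta_deriv 0 ?v (T (of_real t)) = th 0 (of_real y)" using theta_eq[of y] by (simp add: T jacobi_theta1_eq)
  ultimately have "((\<lambda>s. - ln (theta_deriv 0 ?v (T s))) has_field_derivative of_nat N / 2 * (th 2 (of_real y) / th 0 (of_real y))) (at (of_real t))"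
    using theta_nonneg_Reals[OF y] by (auto intro!: derivative_eq_intros simp: field_simps)
  from has_vector_derivative_real_field[OF this]
  have "((\<lambda>s. U N r ts s y) has_vector_derivative of_nat N / 2 * (th 2 (of_real y) / th 0 (of_real y))) (at t)"
    by (simp add: U_def T jacobi_theta1_eq)
  moreover have "th 2 (of_real y) / th 0 (of_real y) = (U' N r ts t y)\<^sup>2 - U'' N r ts t y"
    using y by (simp add: U'_eq U''_eq theta_logderiv'_def)
  ultimately show ?thesis by simp
qed

lemma U'_weierstrass:
  assumes y: "y \<in> {0<..<2 * pi * r}"
  shows "U' N r ts t y = - (zeta (of_real y) - of_real (y / (pi * r)) * eta)"
    and "U'' N r ts t y = wp (of_real y) + 1 / of_real (pi * r) * eta"
proof -
  have "complex_of_real y \<notin> Lam" using y by (intro real_notin_Lam) auto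
  note L = theta_log_derivative[OF this]
  have "2 * eta * of_real y / p = of_real (y / (pi * r)) * eta" "2 * eta / p = 1 / of_real (pi * r) * eta"
    using arg_cong[OF div_p[of y], of "\<lambda>x. 2 * eta * x"] arg_cong[OF div_p[of 1], of "\<lambda>x. 2 * eta * x"] by simp_all
  with L show "U' N r ts t y = - (zeta (of_real y) - of_real (y / (pi * r)) * eta)"
     "U'' N r ts t y = wp (of_real y) + 1 / of_real (pi * r) * eta"
    using U'_eq[OF y] U''_eq[OF y] by simp_all
qed

lemma theta_logderiv_addition:
  assumes "a + b + c = 0" "a \<notin> Lam" "b \<notin> Lam" "c \<notin> Lam"
  shows "(theta_logderiv a + theta_logderiv b + theta_logderiv c)\<^sup>2 = wp a + wp b + wp c"
proof -
  have "theta_logderiv a + theta_logderiv b + theta_logderiv c = zeta a + zeta b + zeta c - 2 * eta * (a + b + c) / p"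
    using assms(2-) by (simp add: theta_log_derivative algebra_simps add_divide_distrib)
  then show ?thesis using zeta_addition[OF assms] assms(1) by simp
qed

end

text \<open>
  Sum the three-term relation over all triples of indices: the mixed products add up to the
  left-hand side.
\<close>
lemma sum_square_three_term:
  fixes a b :: "'n::finite \<Rightarrow> 'n \<Rightarrow> complex"
  assumes anti: "\<And>j k. a k j = - a j k" and sym: "\<And>j k. b k j = b j k" and b0: "\<And>j. b j j = 0"
    and three: "\<And>j k l. j \<noteq> k \<Longrightarrow> k \<noteq> l \<Longrightarrow> l \<noteq> j \<Longrightarrow> (a j k + a k l + a l j)\<^sup>2 = b j k + b k l + b l j"
  shows "2 * (\<Sum>j\<in>UNIV. (\<Sum>k\<in>UNIV. a j k)\<^sup>2) =
    of_nat CARD('n) * (\<Sum>j\<in>UNIV. \<Sum>k\<in>UNIV. (a j k)\<^sup>2) - (of_nat CARD('n) - 2) * (\<Sum>j\<in>UNIV. \<Sum>k\<in>UNIV. b j k)"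
proof -
  let ?N = "of_nat CARD('n) :: complex"
  let ?S = "\<Sum>j\<in>UNIV. \<Sum>k\<in>UNIV. (a j k)\<^sup>2" and ?B = "\<Sum>j\<in>UNIV. \<Sum>k\<in>UNIV. b j k"
  let ?T = "\<Sum>j\<in>UNIV. (\<Sum>k\<in>UNIV. a j k)\<^sup>2"
  have a0: "a j j = 0" for j using anti[of j j] by simp
  \<comment> \<open>On triples with coinciding indices the left side is 0 by antisymmetry, while the
    sum of the \<open>b\<close> is twice one of them or 0. The indicators subtract this excess, so
    that the sums can run over all triples.\<close>
  have total: "(a j k + a k l + a l j)\<^sup>2 = b j k + b k l + b l j
      - ((if j = k then 2 * b k l else 0) + (if k = l then 2 * b l j else 0) + (if l = j then 2 * b j k else 0))" for j k l
  proof -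
    consider "j = k" "k = l" | "j = k" "k \<noteq> l" | "j \<noteq> k" "k = l" | "j \<noteq> k" "l = j" | "j \<noteq> k" "k \<noteq> l" "l \<noteq> j"
      by blast
    then show ?thesis
    proof cases
      case 2
      then show ?thesis using anti[of k l] sym[of k l] by (simp add: a0 b0)
    next
      case 3
      then show ?thesis using anti[of j k] sym[of j k] by (simp add: a0 b0)
    next
      case 4
      then show ?thesis using anti[of j k] sym[of j k] by (simp add: a0 b0)
    qed (simp_all add: a0 b0 three)
  qed
  \<comment> \<open>Antisymmetry rewrites each cyclic product so that both factors share their first
    index; summed over all triples each becomes the sum of squared row sums.\<close>
  have sq: "(a j k + a k l + a l j)\<^sup>2 = (a j k)\<^sup>2 + (a k l)\<^sup>2 + (a l j)\<^sup>2
      - 2 * (a k j * a k l) - 2 * (a l k * a l j) - 2 * (a j l * a j k)" for j k l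
    using anti[of j k] anti[of k l] anti[of l j] by (simp add: power2_eq_square algebra_simps)
  have c1: "(\<Sum>j\<in>UNIV. \<Sum>k\<in>UNIV. \<Sum>l\<in>(UNIV :: 'n set). f j k) = ?N * (\<Sum>j\<in>UNIV. \<Sum>k\<in>UNIV. f j k)" for f :: "'n \<Rightarrow> 'n \<Rightarrow> complex"
    by (simp add: sum_distrib_left)
  have c2: "(\<Sum>j\<in>(UNIV :: 'n set). \<Sum>k\<in>UNIV. \<Sum>l\<in>UNIV. f k l) = ?N * (\<Sum>j\<in>UNIV. \<Sum>k\<in>UNIV. f j k)" for f :: "'n \<Rightarrow> 'n \<Rightarrow> complex"
    by (simp add: sum_distrib_left)
  have c3: "(\<Sum>j\<in>UNIV. \<Sum>k\<in>(UNIV :: 'n set). \<Sum>l\<in>UNIV. f l j) = ?N * (\<Sum>j\<in>UNIV. \<Sum>k\<in>UNIV. f j k)" for f :: "'n \<Rightarrow> 'n \<Rightarrow> complex"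
    by (subst (2) sum.swap) (simp add: sum_distrib_left)
  have e1: "(\<Sum>j\<in>UNIV. \<Sum>k\<in>UNIV. \<Sum>l\<in>UNIV. a j l * a j k) = ?T"
    by (simp add: power2_eq_square sum_product mult.commute)
  have e2: "(\<Sum>j\<in>UNIV. \<Sum>k\<in>UNIV. \<Sum>l\<in>UNIV. a k j * a k l) = ?T"
  proof -
    have "(\<Sum>j\<in>UNIV. \<Sum>k\<in>UNIV. \<Sum>l\<in>UNIV. a k j * a k l) = (\<Sum>k\<in>UNIV. \<Sum>j\<in>UNIV. \<Sum>l\<in>UNIV. a k j * a k l)"
      by (rule sum.swap)
    also have "\<dots> = ?T" by (simp only: power2_eq_square sum_product)
    finally show ?thesis .
  qed
  have e3: "(\<Sum>j\<in>UNIV. \<Sum>k\<in>UNIV. \<Sum>l\<in>UNIV. a l k * a l j) = ?T"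
  proof -
    have "(\<Sum>j\<in>UNIV. \<Sum>k\<in>UNIV. \<Sum>l\<in>UNIV. a l k * a l j) = (\<Sum>j\<in>UNIV. \<Sum>l\<in>UNIV. \<Sum>k\<in>UNIV. a l k * a l j)"
      by (intro sum.cong refl sum.swap)
    also have "\<dots> = (\<Sum>l\<in>UNIV. \<Sum>j\<in>UNIV. \<Sum>k\<in>UNIV. a l k * a l j)" by (rule sum.swap)
    also have "\<dots> = ?T" by (simp add: power2_eq_square sum_product mult.commute)
    finally show ?thesis .
  qed
  have two: "(\<Sum>j\<in>UNIV. \<Sum>k\<in>UNIV. \<Sum>l\<in>UNIV. 2 * f j k l) = 2 * (\<Sum>j\<in>UNIV. \<Sum>k\<in>UNIV. \<Sum>l\<in>UNIV. f j k l)"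
    for f :: "'n \<Rightarrow> 'n \<Rightarrow> 'n \<Rightarrow> complex"
    by (simp only: sum_distrib_left)
  have A: "(\<Sum>j\<in>UNIV. \<Sum>k\<in>UNIV. \<Sum>l\<in>UNIV. (a j k + a k l + a l j)\<^sup>2) = 3 * ?N * ?S - 6 * ?T"
    unfolding sq sum.distrib sum_subtractf two c1[of "\<lambda>j k. (a j k)\<^sup>2"] c2[of "\<lambda>j k. (a j k)\<^sup>2"] c3[of "\<lambda>j k. (a j k)\<^sup>2"]
      e1 e2 e3 by simp
  have i1: "(\<Sum>j\<in>UNIV. \<Sum>k\<in>UNIV. \<Sum>l\<in>UNIV. if j = k then 2 * b k l else 0) = 2 * ?B"
  proof -
    have "(\<Sum>l\<in>UNIV. if j = k then 2 * b k l else 0) = (if j = k then \<Sum>l\<in>UNIV. 2 * b k l else 0)" for j k by simp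
    then show ?thesis by (simp add: sum_distrib_left)
  qed
  have i2: "(\<Sum>j\<in>UNIV. \<Sum>k\<in>UNIV. \<Sum>l\<in>UNIV. if k = l then 2 * b l j else 0) = 2 * ?B"
    by (subst sum.swap) (simp add: sum_distrib_left)
  have i3: "(\<Sum>j\<in>UNIV. \<Sum>k\<in>UNIV. \<Sum>l\<in>UNIV. if l = j then 2 * b j k else 0) = 2 * ?B"
    by (simp add: sum_distrib_left)
  have B: "(\<Sum>j\<in>UNIV. \<Sum>k\<in>UNIV. \<Sum>l\<in>UNIV. (a j k + a k l + a l j)\<^sup>2) = 3 * ?N * ?B - 6 * ?B"
    unfolding total sum.distrib sum_subtractf c1[of b] c2[of b] c3[of b] i1 i2 i3 by simp
  have "3 * ?N * ?S - 6 * ?T = 3 * ?N * ?B - 6 * ?B" using A B by simp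
  then have "3 * (2 * ?T) = 3 * (?N * ?S - (?N - 2) * ?B)" by (simp add: algebra_simps)
  then show ?thesis by (subst (asm) mult_left_cancel) simp_all
qed


section \<open>Partial derivatives of the total potential\<close>

lemma open_alcove: "open (alcove r :: (real ^ 'n::{finite, linorder}) set)"
proof -
  have 1: "{x :: real ^ 'n::{finite, linorder}. \<forall>j k. j < k \<longrightarrow> x $ j < x $ k} = (\<Inter>j. \<Inter>k. if j < k then {x. x $ j < x $ k} else UNIV)"
    by auto
  have "open {x :: real ^ 'n::{finite, linorder}. \<forall>j k. j < k \<longrightarrow> x $ j < x $ k}"
    unfolding 1 by (intro open_INT finite) (auto intro!: open_Collect_less continuous_intros)
  moreover have "open {x :: real ^ 'n::{finite, linorder}. x $ Max UNIV < x $ Min UNIV + 2 * pi * r}"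
    by (intro open_Collect_less continuous_intros)
  moreover have "open {x :: real ^ 'n::{finite, linorder}. 0 < xbar r x}" "open {x :: real ^ 'n::{finite, linorder}. xbar r x < 2 * pi * r}"
    unfolding xbar_def by (intro open_Collect_less continuous_intros)+
  moreover have "alcove r = {x :: real ^ 'n::{finite, linorder}. \<forall>j k. j < k \<longrightarrow> x $ j < x $ k} \<inter> {x. x $ Max UNIV < x $ Min UNIV + 2 * pi * r}
      \<inter> {x. 0 < xbar r x} \<inter> {x. xbar r x < 2 * pi * r}"
    by (auto simp: alcove_def)
  ultimately show ?thesis by (simp add: open_Int)
qed

lemma alcove_diff:
  fixes x :: "real ^ 'n::{finite, linorder}"
  assumes x: "x \<in> alcove r" and "a < b" shows "x $ b - x $ a \<in> {0<..<2 * pi * r}"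
proof -
  have mono: "x $ j \<le> x $ k" if "j \<le> k" for j k
    using that x by (cases "j = k") (auto simp: alcove_def less_imp_le)
  have "x $ b \<le> x $ Max UNIV" "x $ Min UNIV \<le> x $ a" by (simp_all add: mono)
  then show ?thesis using x \<open>a < b\<close> by (force simp: alcove_def)
qed

lemma alcove_xbar: "x \<in> alcove r \<Longrightarrow> xbar r x \<in> {0<..<2 * pi * r}"
  by (simp add: alcove_def)

section \<open>A calculus of partial derivatives on the alcove\<close>

text \<open>A relational form of \<open>d_x\<close>, which carries the existence of the derivative
  together with its value and so obeys sum, product and chain rules.\<close>

definition has_dx :: "'n::finite \<Rightarrow> 'n fn \<Rightarrow> complex \<Rightarrow> real \<times> (real ^ 'n) \<Rightarrow> bool" where
  "has_dx j f g p \<longleftrightarrow> ((\<lambda>s. f (fst p, snd p + s *\<^sub>R axis j 1)) has_vector_derivative g) (at 0)"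

lemma d_x_eq: "has_dx j f g p \<Longrightarrow> d_x j f p = g"
  by (simp add: has_dx_def d_x_def case_prod_unfold vector_derivative_at)

lemma has_dx_mult:
  assumes "has_dx j f f' p" "has_dx j g g' p"
  shows "has_dx j (\<lambda>p. f p * g p) (f p * g' + f' * g p) p"
  using has_vector_derivative_mult[OF assms[unfolded has_dx_def]] by (simp add: has_dx_def)

lemma has_dx_add:
  assumes "has_dx j f f' p" "has_dx j g g' p"
  shows "has_dx j (\<lambda>p. f p + g p) (f' + g') p"
  using has_vector_derivative_add[OF assms[unfolded has_dx_def]] by (simp add: has_dx_def)

lemma has_dx_cmult:
  assumes "has_dx j f f' p" shows "has_dx j (\<lambda>p. c * f p) (c * f') p"
  using has_vector_derivative_mult_right[OF assms[unfolded has_dx_def]] by (simp add: has_dx_def)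

lemma has_dx_exp:
  assumes "has_dx j f f' p" shows "has_dx j (\<lambda>p. exp (f p)) (exp (f p) * f') p"
  using field_vector_diff_chain_at[OF assms[unfolded has_dx_def], of exp "exp (f p)"]
  by (simp add: has_dx_def o_def mult.commute)

text \<open>Agreement at the given time on the open alcove suffices. It is needed for second
  derivatives, as \<open>d_x\<close> is identified with a formula only there.\<close>

lemma has_dx_transform:
  fixes x :: "real ^ 'n::{finite, linorder}"
  assumes f: "has_dx j f f' (t, x)" and x: "x \<in> alcove r" and eq: "\<And>y. y \<in> alcove r \<Longrightarrow> f (t, y) = g (t, y)"
  shows "has_dx j g f' (t, x)"
  unfolding has_dx_def
proof (rule has_vector_derivative_transform_within_open[OF f[unfolded has_dx_def]])
  show "open ((\<lambda>s. x + s *\<^sub>R axis j 1) -` alcove r)"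
    by (intro open_vimage open_alcove continuous_intros)
qed (use x eq in auto)

text \<open>A line in direction \<open>axis j 1\<close> at fixed time meets the domain in an open
  set of parameters, so the derivative within the domain restricts to an ordinary one, even at time
  0.\<close>

lemma has_dx_differentiable:
  fixes x :: "real ^ 'n::{finite, linorder}"
  assumes f: "f differentiable (at (t, x) within {0..<ts} \<times> alcove r)" and tx: "t \<in> {0..<ts}" "x \<in> alcove r"
  shows "has_dx j f (frechet_derivative f (at (t, x) within {0..<ts} \<times> alcove r) (0, axis j 1)) (t, x)"
proof -
  let ?S = "{0..<ts} \<times> (alcove r :: (real ^ 'n::{finite, linorder}) set)" and ?l = "\<lambda>s. (t, x + s *\<^sub>R axis j 1)"
  let ?D = "frechet_derivative f (at (t, x) within ?S)"
  let ?T = "(\<lambda>s. x + s *\<^sub>R axis j 1) -` alcove r"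
  have D: "(f has_derivative ?D) (at (t, x) within ?S)" using f by (simp add: frechet_derivative_works)
  then have D': "(f has_derivative ?D) (at (?l 0) within ?l ` ?T)"
    using tx by (auto intro: has_derivative_subset)
  have l: "(?l has_derivative (\<lambda>s. (0, s *\<^sub>R axis j 1))) (at 0 within ?T)"
    by (auto intro!: derivative_eq_intros)
  have "(f \<circ> ?l has_derivative ?D \<circ> (\<lambda>s. (0, s *\<^sub>R axis j 1))) (at 0 within ?T)"
    by (rule diff_chain_within[OF l D'])
  moreover have "open ?T" by (intro open_vimage open_alcove continuous_intros)
  then have "at 0 within ?T = at 0" using tx by (intro at_within_open) auto
  moreover have "?D (0, s *\<^sub>R axis j 1) = s *\<^sub>R ?D (0, axis j 1)" for s
    using linear_cmul[OF has_derivative_linear[OF D], of s "(0, axis j 1)"] by simp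
  ultimately show ?thesis by (simp add: has_dx_def has_vector_derivative_def o_def)
qed

lemma has_dt_differentiable:
  fixes x :: "real ^ 'n::{finite, linorder}"
  assumes f: "f differentiable (at (t, x) within {0..<ts} \<times> alcove r)" and tx: "t \<in> {0..<ts}" "x \<in> alcove r"
  shows "\<exists>f'. ((\<lambda>s. f (s, x)) has_vector_derivative f') (at t within {0..<ts})"
proof -
  let ?S = "{0..<ts} \<times> (alcove r :: (real ^ 'n::{finite, linorder}) set)" and ?l = "\<lambda>s. (s, x)"
  let ?D = "frechet_derivative f (at (t, x) within ?S)"
  have D: "(f has_derivative ?D) (at (t, x) within ?S)" using f by (simp add: frechet_derivative_works)
  then have D': "(f has_derivative ?D) (at (?l t) within ?l ` {0..<ts})"
    using tx by (auto intro: has_derivative_subset)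
  have l: "(?l has_derivative (\<lambda>s. (s, 0))) (at t within {0..<ts})"
    by (auto intro!: derivative_eq_intros)
  have "(f \<circ> ?l has_derivative ?D \<circ> (\<lambda>s. (s, 0))) (at t within {0..<ts})"
    by (rule diff_chain_within[OF l D'])
  moreover have "?D \<circ> (\<lambda>s. (s, 0)) = (\<lambda>s. s *\<^sub>R ?D (1, 0))"
  proof
    show "(?D \<circ> (\<lambda>s. (s, 0))) s = s *\<^sub>R ?D (1, 0)" for s
      using linear_cmul[OF has_derivative_linear[OF D], of s "(1, 0)"] by (simp only: o_apply scaleR_Pair) simp
  qed
  ultimately have "((\<lambda>s. f (s, x)) has_vector_derivative ?D (1, 0)) (at t within {0..<ts})"
    by (simp only: has_vector_derivative_def o_def)
  then show ?thesis by blast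
qed

text \<open>The points between \<open>t\<close> and \<open>ts\<close> make \<open>t\<close> a limit
  point of the time interval, also for \<open>t = 0\<close>; one-sided derivatives are therefore
  unique.\<close>

lemma d_t_eq:
  assumes "((\<lambda>s. f (s, x)) has_vector_derivative f') (at t within {0..<ts})" "t \<in> {0..<ts}"
  shows "d_t ts f (t, x) = f'"
proof -
  have "t islimpt {t<..<ts}" using assms by (intro islimpt_greaterThanLessThan1) auto
  then have "t islimpt {0..<ts}" by (rule islimpt_subset) (use assms in auto)
  then show ?thesis
    using assms by (simp add: d_t_def vector_derivative_within trivial_limit_within)
qed

section \<open>Gradient, Laplacian and time derivative of the total potential\<close>

text \<open>The rate of change of \<open>x $ b - x $ a\<close> along coordinate \<open>j\<close>,
  that is, a coordinate of the root belonging to the pair.\<close>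

definition inc :: "'n \<Rightarrow> 'n \<Rightarrow> 'n \<Rightarrow> real" where
  "inc j a b = (if b = j then 1 else 0) - (if a = j then 1 else 0)"

definition W_x :: "real \<Rightarrow> real \<Rightarrow> 'n \<Rightarrow> 'n::{finite, linorder} fn" where
  "W_x r ts j = (\<lambda>(t, x). (\<Sum>(a, b)\<in>pairs. of_real (inc j a b) * U' CARD('n) r ts t (x $ b - x $ a))
                       + U' CARD('n) r ts t (xbar r x))"

definition W_xx :: "real \<Rightarrow> real \<Rightarrow> 'n \<Rightarrow> 'n::{finite, linorder} fn" where
  "W_xx r ts j = (\<lambda>(t, x). (\<Sum>(a, b)\<in>pairs. of_real ((inc j a b)\<^sup>2) * U'' CARD('n) r ts t (x $ b - x $ a))
                       + U'' CARD('n) r ts t (xbar r x))"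

lemma has_vector_derivative_affine:
  fixes F :: "real \<Rightarrow> complex"
  assumes "(F has_vector_derivative F') (at y)"
  shows "((\<lambda>s. F (y + s * e)) has_vector_derivative of_real e * F') (at 0)"
proof -
  have "((\<lambda>s. y + s * e) has_vector_derivative e) (at 0)"
    by (auto intro!: derivative_eq_intros simp: has_vector_derivative_def)
  from vector_diff_chain_at[OF this, of F F'] assms show ?thesis by (simp add: o_def scaleR_conv_of_real)
qed

lemma axis_diff: "(x + s *\<^sub>R axis j 1) $ b - (x + s *\<^sub>R axis j 1) $ a = (x $ b - x $ a) + s * inc j a b"
  by (auto simp: inc_def axis_def)

lemma xbar_axis: "xbar r (x + s *\<^sub>R axis j 1) = xbar r x + s * 1"
  by (simp add: xbar_def sum.distrib axis_def if_distrib[of "(*) s"] cong: if_cong)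

lemma pairs_less: "(a, b) \<in> pairs \<Longrightarrow> a < b" by (simp add: pairs_def)

context
  fixes r ts t :: real and x :: "real ^ 'n::{finite, linorder}"
  assumes r: "0 < r" and t: "t < ts" and x: "x \<in> alcove r"
begin

interpretation dyson "CARD('n)" r ts t "of_real (2 * pi * r)" "of_nat CARD('n) * two_omega3 r ts t"
  by unfold_locales (use r t in auto)

lemma has_dx_W: "has_dx j (W r ts) (W_x r ts j (t, x)) (t, x)"
proof -
  have "((\<lambda>s. U CARD('n) r ts t ((x $ b - x $ a) + s * inc j a b)) has_vector_derivative
      of_real (inc j a b) * U' CARD('n) r ts t (x $ b - x $ a)) (at 0)" if "(a, b) \<in> pairs" for a b
    using alcove_diff[OF x pairs_less[OF that]] by (intro has_vector_derivative_affine) (simp only: U_vector_derivative)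
  moreover have "((\<lambda>s. U CARD('n) r ts t (xbar r x + s * 1)) has_vector_derivative
      of_real 1 * U' CARD('n) r ts t (xbar r x)) (at 0)"
    using alcove_xbar[OF x] by (intro has_vector_derivative_affine) (simp only: U_vector_derivative)
  ultimately show ?thesis
    unfolding has_dx_def W_def W_x_def prod.case fst_conv snd_conv case_prod_unfold axis_diff xbar_axis
    by (intro has_vector_derivative_add has_vector_derivative_sum) auto
qed

lemma has_dx_W_x: "has_dx j (W_x r ts j) (W_xx r ts j (t, x)) (t, x)"
proof -
  have "((\<lambda>s. of_real (inc j a b) * U' CARD('n) r ts t ((x $ b - x $ a) + s * inc j a b)) has_vector_derivative
      of_real (inc j a b) * (of_real (inc j a b) * U'' CARD('n) r ts t (x $ b - x $ a))) (at 0)" if "(a, b) \<in> pairs" for a b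
    using alcove_diff[OF x pairs_less[OF that]]
    by (intro has_vector_derivative_affine has_vector_derivative_mult_right) (simp only: U_vector_derivative)
  moreover have "((\<lambda>s. U' CARD('n) r ts t (xbar r x + s * 1)) has_vector_derivative
      of_real 1 * U'' CARD('n) r ts t (xbar r x)) (at 0)"
    using alcove_xbar[OF x] by (intro has_vector_derivative_affine) (simp only: U_vector_derivative)
  ultimately show ?thesis
    unfolding has_dx_def W_x_def W_xx_def prod.case fst_conv snd_conv case_prod_unfold axis_diff xbar_axis
    by (intro has_vector_derivative_add has_vector_derivative_sum) (auto simp: power2_eq_square mult.assoc)
qed

definition W_t :: complex where
  "W_t = of_nat CARD('n) / 2 * ((\<Sum>(a, b)\<in>pairs. (U' CARD('n) r ts t (x $ b - x $ a))\<^sup>2 - U'' CARD('n) r ts t (x $ b - x $ a))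
     + ((U' CARD('n) r ts t (xbar r x))\<^sup>2 - U'' CARD('n) r ts t (xbar r x)))"

lemma W_deriv_t: "((\<lambda>s. W r ts (s, x)) has_vector_derivative W_t) (at t)"
  unfolding W_def W_t_def distrib_left sum_distrib_left
  using alcove_diff[OF x pairs_less] alcove_xbar[OF x] U_deriv_t
  by (auto simp: case_prod_unfold intro!: has_vector_derivative_add has_vector_derivative_sum)

end

lemma sum_pairs_symmetric:
  fixes G :: "'n::{finite, linorder} \<Rightarrow> 'n \<Rightarrow> complex"
  assumes sym: "\<And>a b. G a b = G b a" and "\<And>a. G a a = 0"
  shows "(\<Sum>a\<in>UNIV. \<Sum>b\<in>UNIV. G a b) = 2 * (\<Sum>(a, b)\<in>pairs. G a b)"
proof -
  let ?G = "\<lambda>(a, b). G a b"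
  have U: "UNIV = pairs \<union> (prod.swap ` pairs \<union> range (\<lambda>a :: 'n. (a, a)))"
    by (auto simp: pairs_def image_iff)
  have "(\<Sum>a\<in>UNIV. \<Sum>b\<in>UNIV. G a b) = sum ?G UNIV"
    by (simp add: sum.cartesian_product)
  also have "\<dots> = sum ?G pairs + (sum ?G (prod.swap ` pairs) + sum ?G (range (\<lambda>a :: 'n. (a, a))))"
    by (subst U, subst sum.union_disjoint, simp, simp, force simp: pairs_def, subst sum.union_disjoint) (auto simp: pairs_def)
  also have "sum ?G (prod.swap ` pairs) = sum ?G pairs"
    by (subst sum.reindex) (auto simp: case_prod_unfold sym intro!: sum.cong)
  also have "sum ?G (range (\<lambda>a :: 'n. (a, a))) = 0"
    using assms by (intro sum.neutral) auto
  finally show ?thesis by simp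
qed

lemma card_pairs: "2 * (of_nat (card (pairs :: ('n::{finite, linorder} \<times> 'n) set)) :: complex) = of_nat CARD('n) * (of_nat CARD('n) - 1)"
proof -
  let ?G = "\<lambda>a b :: 'n. if a = b then 0 else 1 :: complex"
  have row: "(\<Sum>b\<in>UNIV. ?G a b) = of_nat CARD('n) - 1" for a
  proof -
    have "(\<Sum>b\<in>UNIV. ?G a b) = (\<Sum>b\<in>UNIV. 1 - (if a = b then 1 else 0))" by (intro sum.cong) auto
    then show ?thesis by (simp add: sum_subtractf)
  qed
  have "(\<Sum>p\<in>(pairs :: ('n \<times> 'n::{finite, linorder}) set). 1 :: complex) = (\<Sum>(a, b)\<in>pairs. ?G a b)"
    by (intro sum.cong) (auto simp: pairs_def)
  moreover have "(\<Sum>a\<in>UNIV. \<Sum>b\<in>UNIV. ?G a b) = 2 * (\<Sum>(a, b)\<in>pairs. ?G a b)"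
    by (rule sum_pairs_symmetric) auto
  ultimately show ?thesis by (simp add: row)
qed


section \<open>The ground state transform\<close>

context
  fixes r ts t :: real and x :: "real ^ 'n::{finite, linorder}"
  assumes r: "0 < r" and t: "t < ts" and x: "x \<in> alcove r"
begin

interpretation dyson "CARD('n)" r ts t "of_real (2 * pi * r)" "of_nat CARD('n) * two_omega3 r ts t"
  by unfold_locales (use r t in auto)

text \<open>The odd continuation of \<open>U'\<close> to differences in either order, since
  \<open>U'_eq\<close> covers positive differences only; with it the gradient becomes a row
  sum.\<close>

private definition A :: "'n \<Rightarrow> 'n \<Rightarrow> complex" where
  "A j k = (if j = k then 0 else - theta_logderiv (of_real (x $ j - x $ k)))"

text \<open>\<open>wp\<close> instead of \<open>U''\<close>, because it is \<open>wp\<close> that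
  satisfies the three-term relation without a constant.\<close>

private definition B :: "'n \<Rightarrow> 'n \<Rightarrow> complex" where
  "B j k = (if j = k then 0 else wp (of_real (x $ j - x $ k)))"

private lemma diff_notin_Lam: "j \<noteq> k \<Longrightarrow> complex_of_real (x $ j - x $ k) \<notin> Lam"
  using alcove_diff[OF x, of j k] alcove_diff[OF x, of k j]
  by (intro real_notin_Lam) (auto simp: neq_iff)

private lemma A_anti: "A k j = - A j k"
  using theta_logderiv_minus[of "of_real (x $ j - x $ k)"] by (simp add: A_def)

private lemma B_sym: "B k j = B j k"
  using wp_minus[OF diff_notin_Lam, of j k] by (simp add: B_def)

private lemma A_three:
  assumes "j \<noteq> k" "k \<noteq> l" "l \<noteq> j"
  shows "(A j k + A k l + A l j)\<^sup>2 = B j k + B k l + B l j"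
proof -
  let ?a = "complex_of_real (x $ j - x $ k)" and ?b = "complex_of_real (x $ k - x $ l)" and ?c = "complex_of_real (x $ l - x $ j)"
  have "(A j k + A k l + A l j)\<^sup>2 = (- (theta_logderiv ?a + theta_logderiv ?b + theta_logderiv ?c))\<^sup>2"
    using assms by (simp only: A_def if_False minus_add_distrib)
  also have "\<dots> = wp ?a + wp ?b + wp ?c"
    unfolding power2_minus using assms by (intro theta_logderiv_addition diff_notin_Lam) (auto simp flip: of_real_add)
  finally show ?thesis using assms by (simp only: B_def if_False)
qed

private lemma A_pairs: "(a, b) \<in> pairs \<Longrightarrow> A b a = U' CARD('n) r ts t (x $ b - x $ a)"
  using alcove_diff[OF x pairs_less] U'_eq pairs_less by (auto simp: A_def simp del: of_real_diff)

private lemma B_pairs: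
  "(a, b) \<in> pairs \<Longrightarrow> B b a = U'' CARD('n) r ts t (x $ b - x $ a) - 1 / of_real (pi * r) * eta"
  using alcove_diff[OF x pairs_less] U'_weierstrass(2) pairs_less by (auto simp: B_def simp del: of_real_diff)

private lemma B_pairs':
  "(a, b) \<in> pairs \<Longrightarrow> B a b = U'' CARD('n) r ts t (x $ b - x $ a) - 1 / of_real (pi * r) * eta"
  by (subst B_sym) (rule B_pairs)

text \<open>\<open>inc j a b\<close> and \<open>A b a\<close> both change sign under exchange of
  \<open>a\<close> and \<open>b\<close>. The sum over pairs is thus half the sum over all ordered
  pairs, in which only row and column \<open>j\<close> survive, with equal contributions.\<close>

private lemma W_x_eq: "W_x r ts j (t, x) = (\<Sum>k\<in>UNIV. A j k) + U' CARD('n) r ts t (xbar r x)"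
proof -
  have "2 * (\<Sum>(a, b)\<in>pairs. of_real (inc j a b) * A b a) = (\<Sum>a\<in>UNIV. \<Sum>b\<in>UNIV. of_real (inc j a b) * A b a)"
  proof (rule sum_pairs_symmetric[symmetric])
    show "of_real (inc j a b) * A b a = of_real (inc j b a) * A a b" for a b
      using A_anti[of b a] by (simp add: inc_def)
  qed (simp add: A_def)
  also have "\<dots> = (\<Sum>a\<in>UNIV. \<Sum>b\<in>UNIV. (if b = j then A b a else 0)) - (\<Sum>a\<in>UNIV. \<Sum>b\<in>UNIV. (if a = j then A b a else 0))"
    unfolding sum_subtractf[symmetric] by (intro sum.cong refl) (simp add: inc_def)
  also have "(\<Sum>a\<in>UNIV. \<Sum>b\<in>UNIV. (if a = j then A b a else 0)) = (\<Sum>b\<in>UNIV. \<Sum>a\<in>UNIV. (if a = j then A b a else 0))"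
    by (rule sum.swap)
  also have "(\<Sum>a\<in>UNIV. \<Sum>b\<in>UNIV. (if b = j then A b a else 0)) - \<dots> = (\<Sum>a\<in>UNIV. A j a) - (\<Sum>b\<in>UNIV. A b j)" by simp
  also have "(\<Sum>b\<in>UNIV. A b j) = - (\<Sum>b\<in>UNIV. A j b)" by (subst A_anti) (simp add: sum_negf)
  finally have "(\<Sum>(a, b)\<in>pairs. of_real (inc j a b) * A b a) = (\<Sum>k\<in>UNIV. A j k)" by simp
  moreover have "(\<Sum>(a, b)\<in>pairs. of_real (inc j a b) * A b a)
      = (\<Sum>(a, b)\<in>pairs. of_real (inc j a b) * U' CARD('n) r ts t (x $ b - x $ a))"
    by (intro sum.cong) (auto simp: A_pairs)
  ultimately show ?thesis by (simp add: W_x_def)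
qed

text \<open>Each difference depends on two coordinates, with slopes 1 and -1, and
  \<open>xbar\<close> on all \<open>N\<close> of them.\<close>

private lemma sum_W_xx:
  "(\<Sum>j\<in>UNIV. W_xx r ts j (t, x)) = 2 * (\<Sum>(a, b)\<in>pairs. U'' CARD('n) r ts t (x $ b - x $ a))
     + of_nat CARD('n) * U'' CARD('n) r ts t (xbar r x)"
proof -
  have two: "(\<Sum>j\<in>UNIV. complex_of_real ((inc j a b)\<^sup>2)) = 2" if "(a, b) \<in> pairs" for a b :: 'n
  proof -
    have "(inc j a b)\<^sup>2 = (if b = j then 1 else 0) + (if a = j then 1 else 0)" for j
      using pairs_less[OF that] by (auto simp: inc_def)
    then have "(\<Sum>j\<in>UNIV. (inc j a b)\<^sup>2) = 2" by (simp add: sum.distrib)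
    then show ?thesis by (metis of_real_sum of_real_numeral)
  qed
  have "(\<Sum>j\<in>UNIV. \<Sum>(a, b)\<in>pairs. of_real ((inc j a b)\<^sup>2) * U'' CARD('n) r ts t (x $ b - x $ a))
     = (\<Sum>(a, b)\<in>pairs. \<Sum>j\<in>UNIV. of_real ((inc j a b)\<^sup>2) * U'' CARD('n) r ts t (x $ b - x $ a))"
    by (subst sum.swap) (simp only: case_prod_unfold)
  also have "\<dots> = (\<Sum>(a, b)\<in>pairs. 2 * U'' CARD('n) r ts t (x $ b - x $ a))"
    unfolding sum_distrib_right[symmetric] by (intro sum.cong refl) (auto simp only: two prod.case split: prod.split)
  also have "\<dots> = 2 * (\<Sum>(a, b)\<in>pairs. U'' CARD('n) r ts t (x $ b - x $ a))"
    by (simp add: sum_distrib_left case_prod_unfold)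
  finally show ?thesis by (simp only: W_xx_def prod.case sum.distrib) simp
qed

text \<open>The mixed term with \<open>xbar\<close> is proportional to the sum of all
  \<open>A j k\<close> and vanishes by antisymmetry. Replacing \<open>wp\<close> by
  \<open>U''\<close> subtracts \<open>eta / (pi * r)\<close> for each of the
  \<open>N * (N - 1) / 2\<close> pairs.\<close>

private lemma sum_W_x_sq:
  "(\<Sum>j\<in>UNIV. (W_x r ts j (t, x))\<^sup>2) =
     of_nat CARD('n) * ((\<Sum>(a, b)\<in>pairs. (U' CARD('n) r ts t (x $ b - x $ a))\<^sup>2) + (U' CARD('n) r ts t (xbar r x))\<^sup>2)
     - (of_nat CARD('n) - 2) * ((\<Sum>(a, b)\<in>pairs. U'' CARD('n) r ts t (x $ b - x $ a))
        - of_nat CARD('n) * (of_nat CARD('n) - 1) / 2 * (1 / of_real (pi * r) * eta))"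
proof -
  let ?N = "of_nat CARD('n) :: complex" and ?u = "U' CARD('n) r ts t (xbar r x)"
  let ?S1 = "\<Sum>(a, b)\<in>pairs. (U' CARD('n) r ts t (x $ b - x $ a))\<^sup>2"
  let ?S2 = "\<Sum>(a, b)\<in>pairs. U'' CARD('n) r ts t (x $ b - x $ a)"
  let ?e = "1 / of_real (pi * r) * eta"
  have "(\<Sum>j\<in>UNIV. \<Sum>k\<in>UNIV. (A j k)\<^sup>2) = 2 * (\<Sum>(a, b)\<in>pairs. (A a b)\<^sup>2)"
    by (rule sum_pairs_symmetric) (metis A_anti power2_minus, simp add: A_def)
  also have "(\<Sum>(a, b)\<in>pairs. (A a b)\<^sup>2) = ?S1"
    by (intro sum.cong refl) (auto, metis A_anti A_pairs power2_minus)
  finally have AA: "(\<Sum>j\<in>UNIV. \<Sum>k\<in>UNIV. (A j k)\<^sup>2) = 2 * ?S1" .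
  have "(\<Sum>j\<in>UNIV. \<Sum>k\<in>UNIV. B j k) = 2 * (\<Sum>(a, b)\<in>pairs. B a b)"
    by (rule sum_pairs_symmetric) (rule B_sym, simp add: B_def)
  also have "(\<Sum>(a, b)\<in>pairs. B a b) = (\<Sum>(a, b)\<in>pairs. U'' CARD('n) r ts t (x $ b - x $ a) - ?e)"
    by (intro sum.cong refl) (clarsimp simp only: B_pairs')
  also have "\<dots> = ?S2 - of_nat (card (pairs :: ('n \<times> 'n::{finite, linorder}) set)) * ?e"
    by (simp add: case_prod_unfold sum_subtractf)
  also have "2 * (?S2 - of_nat (card (pairs :: ('n \<times> 'n::{finite, linorder}) set)) * ?e) = 2 * ?S2 - ?N * (?N - 1) * ?e"
    by (simp only: right_diff_distrib mult.assoc[symmetric] card_pairs)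
  finally have BB: "(\<Sum>j\<in>UNIV. \<Sum>k\<in>UNIV. B j k) = 2 * ?S2 - ?N * (?N - 1) * ?e" .
  have halve: "T = N * S1 - (N - 2) * (S2 - N * (N - 1) / 2 * e)"
    if "2 * T = N * (2 * S1) - (N - 2) * (2 * S2 - N * (N - 1) * e)" for T N S1 S2 e :: complex
  proof -
    have "2 * T = 2 * (N * S1 - (N - 2) * (S2 - N * (N - 1) / 2 * e))" unfolding that by (simp add: field_simps)
    then show ?thesis by (subst (asm) mult_left_cancel) simp_all
  qed
  have "B j j = 0" for j by (simp add: B_def)
  from sum_square_three_term[of A B, OF A_anti B_sym this A_three, unfolded AA BB]
  have T: "(\<Sum>j\<in>UNIV. (\<Sum>k\<in>UNIV. A j k)\<^sup>2) = ?N * ?S1 - (?N - 2) * (?S2 - ?N * (?N - 1) / 2 * ?e)"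
    by (rule halve)
  have "(\<Sum>j\<in>UNIV. \<Sum>k\<in>UNIV. A j k) = - (\<Sum>j\<in>UNIV. \<Sum>k\<in>UNIV. A k j)"
    by (subst A_anti) (simp add: sum_negf)
  also have "(\<Sum>j\<in>UNIV. \<Sum>k\<in>UNIV. A k j) = (\<Sum>j\<in>UNIV. \<Sum>k\<in>UNIV. A j k)" by (rule sum.swap)
  finally have Z: "(\<Sum>j\<in>UNIV. \<Sum>k\<in>UNIV. A j k) = 0" by simp
  have "(\<Sum>j\<in>UNIV. (W_x r ts j (t, x))\<^sup>2)
      = (\<Sum>j\<in>UNIV. (\<Sum>k\<in>UNIV. A j k)\<^sup>2 + 2 * ?u * (\<Sum>k\<in>UNIV. A j k) + ?u\<^sup>2)"
    by (intro sum.cong refl) (simp add: W_x_eq power2_sum)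
  also have "\<dots> = (\<Sum>j\<in>UNIV. (\<Sum>k\<in>UNIV. A j k)\<^sup>2) + 2 * ?u * (\<Sum>j\<in>UNIV. \<Sum>k\<in>UNIV. A j k) + ?N * ?u\<^sup>2"
    by (simp only: sum.distrib sum_distrib_left[symmetric]) simp
  finally show ?thesis unfolding T Z by (simp add: algebra_simps)
qed

text \<open>At \<open>xbar\<close> the second derivatives enter with \<open>\<beta> * N / 4\<close>
  from time and the opposite from the Laplacian. For pairs
  \<open>\<beta> * N / 4 - \<beta> / 2 = \<beta> * (N - 2) / 4\<close> meets
  \<open>- \<beta>^2 * (N - 2) / 8\<close> from the gradient, and the \<open>eta\<close> term of the
  gradient is minus the energy.\<close>

lemma ground_state:
  "of_real (- \<beta> / 2) * W_t r ts t x - of_real (\<beta> / 4) * (\<Sum>j\<in>UNIV. W_xx r ts j (t, x))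
     + of_real (\<beta>\<^sup>2 / 8) * (\<Sum>j\<in>UNIV. (W_x r ts j (t, x))\<^sup>2)
   = potential_V \<beta> r ts (t, x) - energy_E0 CARD('n) \<beta> r ts t"
proof -
  define S1 where "S1 = (\<Sum>(a, b)\<in>pairs. (U' CARD('n) r ts t (x $ b - x $ a))\<^sup>2)"
  define S2 where "S2 = (\<Sum>(a, b)\<in>pairs. U'' CARD('n) r ts t (x $ b - x $ a))"
  define u where "u = U' CARD('n) r ts t (xbar r x)"
  define v where "v = U'' CARD('n) r ts t (xbar r x)"
  define N where "N = (of_nat CARD('n) :: complex)"
  define e where "e = 1 / of_real (pi * r) * eta"
  define b where "b = complex_of_real \<beta>"
  have N0: "N \<noteq> 0" by (simp add: N_def)
  have "W_t r ts t x = N / 2 * ((S1 - S2) + (u\<^sup>2 - v))"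
    by (simp add: W_t_def[OF r t x] S1_def S2_def u_def v_def N_def case_prod_unfold sum_subtractf)
  moreover have "potential_V \<beta> r ts (t, x) = b * (b - 2) / 8 * N * (S1 + u\<^sup>2 - (N - 2) / N * S2)"
    by (simp add: potential_V_def S1_def S2_def u_def N_def b_def)
  moreover have "energy_E0 CARD('n) \<beta> r ts t = - (b\<^sup>2 / 16) * N * (N - 1) * (N - 2) * e"
    by (simp add: energy_E0_def N_def b_def e_def)
  moreover have "b * (b - 2) / 8 * N * (S1 + u\<^sup>2 - (N - 2) / N * S2) = b * (b - 2) / 8 * (N * (S1 + u\<^sup>2) - (N - 2) * S2)"
    using N0 by (simp add: field_simps)
  moreover have "complex_of_real (- \<beta> / 2) = - b / 2" "complex_of_real (\<beta> / 4) = b / 4" "complex_of_real (\<beta>\<^sup>2 / 8) = b\<^sup>2 / 8"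
    by (simp_all add: b_def)
  moreover have "(- b / 2) * (N / 2 * ((S1 - S2) + (u\<^sup>2 - v))) - b / 4 * (2 * S2 + N * v)
      + b\<^sup>2 / 8 * (N * (S1 + u\<^sup>2) - (N - 2) * (S2 - N * (N - 1) / 2 * e))
     = b * (b - 2) / 8 * (N * (S1 + u\<^sup>2) - (N - 2) * S2) - (- (b\<^sup>2 / 16) * N * (N - 1) * (N - 2) * e)"
    by (simp add: field_simps power2_eq_square)
  ultimately show ?thesis
    unfolding sum_W_xx sum_W_x_sq S1_def[symmetric] S2_def[symmetric] u_def[symmetric] v_def[symmetric]
      e_def[symmetric]
    unfolding N_def[symmetric] by (simp only:)
qed

lemma potential_V_weierstrass:
  "let N = CARD('n);
            p = of_real (2 * pi * r);
            q = of_nat N * two_omega3 r ts t;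
            \<eta>\<^sub>1 = weierstrass_eta1 p q;
            \<zeta> = (\<lambda>y::real. weierstrass_zeta p q (of_real y));
            P = (\<lambda>y::real. weierstrass_p p q (of_real y))
        in potential_V \<beta> r ts (t, x) =
           of_real (\<beta> * (\<beta> - 2) / 8) * of_nat N *
             ((\<Sum>(j, k)\<in>pairs. (\<zeta> (x $ k - x $ j)
                                 - of_real ((x $ k - x $ j) / (pi * r)) * \<eta>\<^sub>1)\<^sup>2)
              + (\<zeta> (xbar r x) - of_real (xbar r x / (pi * r)) * \<eta>\<^sub>1)\<^sup>2
              - (of_nat N - 2) / of_nat N
                * (\<Sum>(j, k)\<in>pairs. (P (x $ k - x $ j) + 1 / of_real (pi * r) * \<eta>\<^sub>1)))"
proof -
  have "(\<Sum>(j, k)\<in>pairs. (U' CARD('n) r ts t (x $ k - x $ j))\<^sup>2)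
      = (\<Sum>(j, k)\<in>pairs. (zeta (of_real (x $ k - x $ j)) - of_real ((x $ k - x $ j) / (pi * r)) * eta)\<^sup>2)"
    by (intro sum.cong refl) (clarsimp simp only: U'_weierstrass(1)[OF alcove_diff[OF x pairs_less]] power2_minus)
  moreover have "(\<Sum>(j, k)\<in>pairs. U'' CARD('n) r ts t (x $ k - x $ j))
      = (\<Sum>(j, k)\<in>pairs. wp (of_real (x $ k - x $ j)) + 1 / of_real (pi * r) * eta)"
    by (intro sum.cong refl) (clarsimp simp only: U'_weierstrass(2)[OF alcove_diff[OF x pairs_less]])
  ultimately show ?thesis
    by (simp only: Let_def potential_V_def prod.case U'_weierstrass(1)[OF alcove_xbar[OF x]] power2_minus)
qed

end

section \<open>Conjugation of the Kolmogorov operator\<close>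

lemma ground_state_conjugation:
  fixes x :: "real ^ 'n::{finite, linorder}" and f :: "'n fn"
  assumes r: "0 < r" and f: "smooth_on ({0..<ts} \<times> alcove r) f" and t: "t \<in> {0..<ts}" and x: "x \<in> alcove r"
  shows "(mult_op (exp_W (\<beta> / 2) r ts)
            \<circ> (\<lambda>g p. d_t ts g p - kolmogorov_L \<beta> r ts g p)
            \<circ> mult_op (exp_W (- \<beta> / 2) r ts)) f (t, x)
          = d_t ts f (t, x)
            + (hamiltonian_H \<beta> r ts f (t, x) - energy_E0 CARD('n) \<beta> r ts t * f (t, x))"
proof -
  let ?S = "{0..<ts} \<times> (alcove r :: (real ^ 'n::{finite, linorder}) set)"
  have t': "t < ts" using t by simp
  define F1 where "F1 = (\<lambda>j p. frechet_derivative f (at p within ?S) (0, axis j 1))"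
  define F2 where "F2 = (\<lambda>j p. frechet_derivative (F1 j) (at p within ?S) (0, axis j 1))"
  have "C_k 2 ?S f" using f by (simp add: smooth_on_def)
  then have diff: "f differentiable_on ?S" "F1 j differentiable_on ?S" for j
    by (simp_all add: numeral_2_eq_2 F1_def)
  have f1: "has_dx j f (F1 j (t, y)) (t, y)" if "y \<in> alcove r" for j y
    unfolding F1_def using diff(1) t that by (intro has_dx_differentiable) (auto simp: differentiable_on_def)
  have f2: "has_dx j (F1 j) (F2 j (t, x)) (t, x)" for j
    unfolding F2_def using diff(2) t x by (intro has_dx_differentiable) (auto simp: differentiable_on_def)
  define c where "c = complex_of_real (- \<beta> / 2)"
  define \<phi> where "\<phi> = (exp_W (- \<beta> / 2) r ts :: 'n fn)"
  define g where "g = mult_op \<phi> f"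
  have \<phi>_eq: "\<phi> = (\<lambda>p. exp (c * W r ts p))" by (simp add: \<phi>_def exp_W_def c_def)
  have \<phi>_dx: "has_dx j \<phi> (\<phi> (t, y) * (c * W_x r ts j (t, y))) (t, y)" if "y \<in> alcove r" for j y
    unfolding \<phi>_eq by (intro has_dx_exp has_dx_cmult has_dx_W r t' that)
  define g1 where "g1 = (\<lambda>j p. \<phi> p * F1 j p + \<phi> p * (c * W_x r ts j p) * f p)"
  have g_dx: "has_dx j g (g1 j (t, y)) (t, y)" if "y \<in> alcove r" for j y
    using has_dx_mult[OF \<phi>_dx[OF that] f1[OF that]] by (simp add: g_def mult_op_def g1_def)
  have W_x_dx: "has_dx j (W_x r ts j) (W_xx r ts j (t, x)) (t, x)" for j
    by (rule has_dx_W_x[OF r t' x])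
  \<comment> \<open>Left in the form that the product rule returns, so that the derivative rules
    apply without rearrangement.\<close>
  define G2 where "G2 = (\<lambda>j. (\<phi> (t, x) * F2 j (t, x) + \<phi> (t, x) * (c * W_x r ts j (t, x)) * F1 j (t, x))
     + (\<phi> (t, x) * (c * W_x r ts j (t, x)) * F1 j (t, x)
      + (\<phi> (t, x) * (c * W_xx r ts j (t, x)) + \<phi> (t, x) * (c * W_x r ts j (t, x)) * (c * W_x r ts j (t, x))) * f (t, x)))"
  have "has_dx j (g1 j) (G2 j) (t, x)" for j
    unfolding g1_def G2_def
    by (intro has_dx_add has_dx_mult has_dx_cmult \<phi>_dx f1 f2 W_x_dx x)
  then have "has_dx j (d_x j g) (G2 j) (t, x)" for j
    by (rule has_dx_transform[OF _ x]) (simp add: d_x_eq[OF g_dx])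
  then have ddg: "d_x j (d_x j g) (t, x) = G2 j" for j by (rule d_x_eq)
  have "has_dx j (\<lambda>p. W_x r ts j p * g p) (W_x r ts j (t, x) * g1 j (t, x) + W_xx r ts j (t, x) * g (t, x)) (t, x)" for j
    by (intro has_dx_mult W_x_dx g_dx x)
  then have "has_dx j (mult_op (d_x j (W r ts)) g) (W_x r ts j (t, x) * g1 j (t, x) + W_xx r ts j (t, x) * g (t, x)) (t, x)" for j
    by (rule has_dx_transform[OF _ x]) (simp add: mult_op_def d_x_eq[OF has_dx_W[OF r t']])
  then have dWg: "d_x j (mult_op (d_x j (W r ts)) g) (t, x) = W_x r ts j (t, x) * g1 j (t, x) + W_xx r ts j (t, x) * g (t, x)" for j
    by (rule d_x_eq)
  have "has_dx j (d_x j f) (F2 j (t, x)) (t, x)" for j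
    by (rule has_dx_transform[OF f2 x]) (simp add: d_x_eq[OF f1])
  then have ddf: "d_x j (d_x j f) (t, x) = F2 j (t, x)" for j by (rule d_x_eq)
  have cc: "c = - of_real \<beta> / 2" by (simp add: c_def)
  have L: "kolmogorov_L \<beta> r ts g (t, x) = \<phi> (t, x) * (1 / 2 * (\<Sum>j\<in>UNIV. F2 j (t, x))
     + of_real (\<beta> / 4) * (\<Sum>j\<in>UNIV. W_xx r ts j (t, x)) * f (t, x)
     - of_real (\<beta>\<^sup>2 / 8) * (\<Sum>j\<in>UNIV. (W_x r ts j (t, x))\<^sup>2) * f (t, x))"
  proof -
    \<comment> \<open>With \<open>c = - \<beta> / 2\<close> the terms in \<open>F1\<close> cancel:
      the Laplacian gives \<open>c * W_x\<close> and the drift \<open>\<beta> / 2 * W_x\<close>. For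
      \<open>W_xx\<close> the balance is \<open>- \<beta> / 4 + \<beta> / 2\<close>, for the square
      of \<open>W_x\<close> it is \<open>\<beta>^2 / 8 - \<beta>^2 / 4\<close>.\<close>
    have "1 / 2 * G2 j + of_real \<beta> / 2 * (W_x r ts j (t, x) * g1 j (t, x) + W_xx r ts j (t, x) * g (t, x))
       = \<phi> (t, x) * (1 / 2 * F2 j (t, x) + of_real (\<beta> / 4) * W_xx r ts j (t, x) * f (t, x)
           - of_real (\<beta>\<^sup>2 / 8) * (W_x r ts j (t, x))\<^sup>2 * f (t, x))" for j
      unfolding G2_def g1_def g_def mult_op_def cc by (simp add: field_simps power2_eq_square)
    then have "kolmogorov_L \<beta> r ts g (t, x) = (\<Sum>j\<in>UNIV. \<phi> (t, x) * (1 / 2 * F2 j (t, x) + of_real (\<beta> / 4) * W_xx r ts j (t, x) * f (t, x)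
           - of_real (\<beta>\<^sup>2 / 8) * (W_x r ts j (t, x))\<^sup>2 * f (t, x)))"
      unfolding kolmogorov_L_def ddg dWg sum_distrib_left by (simp flip: sum.distrib)
    then show ?thesis
      by (simp only: sum_distrib_left[symmetric] sum_distrib_right[symmetric] sum.distrib sum_subtractf)
  qed
  obtain f' where f': "((\<lambda>s. f (s, x)) has_vector_derivative f') (at t within {0..<ts})"
    using has_dt_differentiable[of f t x ts r] diff(1) t x by (auto simp: differentiable_on_def)
  have "((\<lambda>s. c * W r ts (s, x)) has_vector_derivative c * W_t r ts t x) (at t)"
    by (intro has_vector_derivative_mult_right W_deriv_t[OF r t' x])
  from field_vector_diff_chain_at[OF this, of exp "exp (c * W r ts (t, x))"]
  have "((\<lambda>s. \<phi> (s, x)) has_vector_derivative \<phi> (t, x) * (c * W_t r ts t x)) (at t)"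
    by (simp add: \<phi>_def exp_W_def c_def o_def mult.commute)
  \<comment> \<open>The weight is differentiable on both sides of \<open>t\<close>, \<open>f\<close>
    perhaps only from the right at 0; the product rule needs the common restriction.\<close>
  then have "((\<lambda>s. \<phi> (s, x)) has_vector_derivative \<phi> (t, x) * (c * W_t r ts t x)) (at t within {0..<ts})"
    by (rule has_vector_derivative_at_within)
  from has_vector_derivative_mult[OF this f']
  have dtg: "d_t ts g (t, x) = \<phi> (t, x) * (f' + c * W_t r ts t x * f (t, x))"
    by (intro d_t_eq[OF _ t]) (simp add: g_def mult_op_def algebra_simps)
  have inv: "exp_W (\<beta> / 2) r ts (t, x) * \<phi> (t, x) = 1"
    by (simp add: exp_W_def \<phi>_def flip: exp_add)
  have "(mult_op (exp_W (\<beta> / 2) r ts) \<circ> (\<lambda>g p. d_t ts g p - kolmogorov_L \<beta> r ts g p) \<circ> mult_op (exp_W (- \<beta> / 2) r ts)) f (t, x)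
     = exp_W (\<beta> / 2) r ts (t, x) * (d_t ts g (t, x) - kolmogorov_L \<beta> r ts g (t, x))"
    by (simp add: mult_op_def[of "exp_W (\<beta> / 2) r ts"] g_def \<phi>_def)
  also have "\<dots> = (exp_W (\<beta> / 2) r ts (t, x) * \<phi> (t, x)) * (f' - 1 / 2 * (\<Sum>j\<in>UNIV. F2 j (t, x))
      + (c * W_t r ts t x - of_real (\<beta> / 4) * (\<Sum>j\<in>UNIV. W_xx r ts j (t, x))
     + of_real (\<beta>\<^sup>2 / 8) * (\<Sum>j\<in>UNIV. (W_x r ts j (t, x))\<^sup>2)) * f (t, x))"
    unfolding dtg L by (simp add: algebra_simps)
  also have "\<dots> = f' - 1 / 2 * (\<Sum>j\<in>UNIV. F2 j (t, x)) + (potential_V \<beta> r ts (t, x) - energy_E0 CARD('n) \<beta> r ts t) * f (t, x)"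
    unfolding inv c_def ground_state[OF r t' x] by simp
  also have "\<dots> = d_t ts f (t, x) + (hamiltonian_H \<beta> r ts f (t, x) - energy_E0 CARD('n) \<beta> r ts t * f (t, x))"
    by (simp add: d_t_eq[OF f' t] hamiltonian_H_def ddf algebra_simps)
  finally show ?thesis .
qed

theorem lemma3p1:
  fixes r ts \<beta> :: real
  assumes "2 \<le> CARD('n::{finite, linorder})" and "0 < r" and "0 < ts" and "0 < \<beta>"
  shows
    "(\<forall>f :: 'n fn. smooth_on ({0..<ts} \<times> alcove r) f \<longrightarrow>
       (\<forall>t\<in>{0..<ts}. \<forall>x\<in>alcove r.
          (mult_op (exp_W (\<beta> / 2) r ts)
            \<circ> (\<lambda>g p. d_t ts g p - kolmogorov_L \<beta> r ts g p)
            \<circ> mult_op (exp_W (- \<beta> / 2) r ts)) f (t, x)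
          = d_t ts f (t, x)
            + (hamiltonian_H \<beta> r ts f (t, x) - energy_E0 CARD('n) \<beta> r ts t * f (t, x))))
     \<and>
     (\<forall>t\<in>{0..<ts}. \<forall>x\<in>(alcove r :: (real ^ 'n::{finite, linorder}) set).
        let N = CARD('n);
            p = of_real (2 * pi * r);
            q = of_nat N * two_omega3 r ts t;
            \<eta>\<^sub>1 = weierstrass_eta1 p q;
            \<zeta> = (\<lambda>y::real. weierstrass_zeta p q (of_real y));
            P = (\<lambda>y::real. weierstrass_p p q (of_real y))
        in potential_V \<beta> r ts (t, x) =
           of_real (\<beta> * (\<beta> - 2) / 8) * of_nat N *
             ((\<Sum>(j, k)\<in>pairs. (\<zeta> (x $ k - x $ j)
                                 - of_real ((x $ k - x $ j) / (pi * r)) * \<eta>\<^sub>1)\<^sup>2)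
              + (\<zeta> (xbar r x) - of_real (xbar r x / (pi * r)) * \<eta>\<^sub>1)\<^sup>2
              - (of_nat N - 2) / of_nat N
                * (\<Sum>(j, k)\<in>pairs. (P (x $ k - x $ j) + 1 / of_real (pi * r) * \<eta>\<^sub>1))))"
  by (intro conjI allI impI ballI ground_state_conjugation potential_V_weierstrass) (use assms in auto)

end
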